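(* There exists a topologically numerically transitive operator on $B_2(H)$ which is not topologically C*-transitive. In particular, there exists a numerically hypercyclic operator on $B_2(H)$ which is not topologically C*-transitive.
   Context: $H$ is a complex separable infinite-dimensional Hilbert space; $B_2(H)$ is the space of Hilbert–Schmidt operators with the Hilbert–Schmidt norm, $B_1(H)$ the space of trace class operators with the trace norm. For a complex Banach space $X$ with unit spheres $S_X$, $S_{X^*}$, $\Pi(X):=\{(x,x^* )\in S_X\times S_{X^*}:x^*(x)=1\}$ with the topology induced by the norm $\max\{\|x\|,\|x^*\|\}$. $T\in\mathcal B(X)$ is numerically hypercyclic if there is $(x,x^* )\in\Pi(X)$ with $\{x^*(T^nx):n\ge0\}$ dense in $\mathbb C$; it is topologically numerically transitive if for every nonempty open $U\subset\Pi(X)$ and nonempty open $V\subset\mathbb C$ there exist $n\ge0$ and $(x,x^* )\in U$ with $x^*(T^nx)\in V$. $T\in\mathcal B(B_2(H))$ is topologically C*-transitive (with respect to $\varphi:B_2(H)\times B_2(H)\to B_1(H)$, $\varphi(A,B)=B^*A$) if for every nonempty open $W\subseteq S(B_2(H))\times S(B_2(H))$ (product of unit spheres) and nonempty open $O\subseteq B_1(H)$ there exist $n\in\mathbb N$ and $(A,B)\in W$ with $B^*T^n(A)\in O$. *)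

theory Defs
  imports "HOL-Analysis.Analysis"
begin

section \<open>Complex normed spaces and complex Hilbert spaces\<close>

class complex_vector = real_vector +
  fixes scaleC :: "complex \<Rightarrow> 'a \<Rightarrow> 'a" (infixr \<open>*\<^sub>C\<close> 75)
  assumes scaleC_add_right: "a *\<^sub>C (x + y) = a *\<^sub>C x + a *\<^sub>C y"
    and scaleC_add_left: "(a + b) *\<^sub>C x = a *\<^sub>C x + b *\<^sub>C x"
    and scaleC_scaleC: "a *\<^sub>C b *\<^sub>C x = (a * b) *\<^sub>C x"
    and scaleC_one: "1 *\<^sub>C x = x"
    and scaleR_scaleC: "r *\<^sub>R x = complex_of_real r *\<^sub>C x"

global_interpretation complex_vector: vector_space "scaleC :: complex \<Rightarrow> 'a \<Rightarrow> 'a::complex_vector"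
  by unfold_locales
    (simp_all add: scaleC_add_right scaleC_add_left scaleC_scaleC scaleC_one)

abbreviation cspan :: "'a::complex_vector set \<Rightarrow> 'a set"
  where "cspan \<equiv> complex_vector.span"

class complex_normed_vector = complex_vector + real_normed_vector +
  assumes norm_scaleC: "norm (a *\<^sub>C x) = cmod a * norm x"

instantiation complex :: complex_normed_vector
begin

definition scaleC_complex :: "complex \<Rightarrow> complex \<Rightarrow> complex"
  where "scaleC_complex a x = a * x"

instance
  by standard (simp_all add: scaleC_complex_def algebra_simps norm_mult scaleR_conv_of_real)

end

class complex_inner = complex_normed_vector +
  fixes cinner :: "'a \<Rightarrow> 'a \<Rightarrow> complex"
  assumes cinner_commute: "cinner x y = cnj (cinner y x)"
    and cinner_add_left: "cinner (x + y) z = cinner x z + cinner y z"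
    and cinner_scaleC_left: "cinner (a *\<^sub>C x) y = a * cinner x y"
    and cinner_self_nonneg: "cinner x x \<in> \<real>\<^sub>\<ge>\<^sub>0"
    and norm_eq_sqrt_cinner: "norm x = sqrt (Re (cinner x x))"

class chilbert_space = complex_inner + complete_space

definition finite_cdim :: "'a::complex_vector itself \<Rightarrow> bool"
  where "finite_cdim _ \<longleftrightarrow> (\<exists>B::'a set. finite B \<and> cspan B = UNIV)"

text \<open>
  Bounded complex-linear maps are the elements of the library type of bounded real-linear maps
  that also commute with complex scalars; their norm is the usual operator norm, since that norm
  does not depend on the scalar field.
\<close>
definition complex_linear :: "('a::complex_normed_vector \<Rightarrow>\<^sub>L 'b::complex_normed_vector) \<Rightarrow> bool"
  where "complex_linear A \<longleftrightarrow> (\<forall>c x. A (c *\<^sub>C x) = c *\<^sub>C A x)"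

section \<open>Orthonormal bases\<close>

definition orthonormal :: "'h::complex_inner set \<Rightarrow> bool"
  where "orthonormal E \<longleftrightarrow>
    (\<forall>e\<in>E. norm e = 1) \<and> (\<forall>e\<in>E. \<forall>f\<in>E. e \<noteq> f \<longrightarrow> cinner e f = 0)"

definition is_onb :: "'h::complex_inner set \<Rightarrow> bool"
  where "is_onb E \<longleftrightarrow> orthonormal E \<and> closure (cspan E) = UNIV"

definition some_onb :: "'h::chilbert_space set"
  where "some_onb = (SOME E. is_onb E)"

lemma cinner_add_right: "cinner x (y + z) = cinner x y + cinner x (z::'a::complex_inner)"
  by (metis cinner_add_left cinner_commute complex_cnj_add)

lemma cinner_scaleC_right: "cinner x (a *\<^sub>C y) = cnj a * cinner x (y::'a::complex_inner)"
  by (metis cinner_commute cinner_scaleC_left complex_cnj_mult)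

lemma cinner_zero_left [simp]: "cinner 0 (x::'a::complex_inner) = 0"
  using cinner_add_left[of 0 0 x] by simp

lemma cinner_zero_right [simp]: "cinner (x::'a::complex_inner) 0 = 0"
  using cinner_add_right[of x 0 0] by simp

lemma cinner_minus_left: "cinner (- x) (y::'a::complex_inner) = - cinner x y"
  using cinner_add_left[of x "- x" y] by (simp add: eq_neg_iff_add_eq_0 add.commute)

lemma cinner_minus_right: "cinner x (- y::'a::complex_inner) = - cinner x y"
  using cinner_add_right[of x y "- y"] by (simp add: eq_neg_iff_add_eq_0 add.commute)

lemma cinner_diff_left: "cinner (x - y) (z::'a::complex_inner) = cinner x z - cinner y z"
  using cinner_add_left[of x "- y" z] by (simp add: cinner_minus_left)

lemma cinner_diff_right: "cinner x (y - z::'a::complex_inner) = cinner x y - cinner x z"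
  using cinner_add_right[of x y "- z"] by (simp add: cinner_minus_right)

lemma cinner_sum_left: "cinner (sum f F) (y::'a::complex_inner) = (\<Sum>i\<in>F. cinner (f i) y)"
  by (induction F rule: infinite_finite_induct) (simp_all add: cinner_add_left)

lemma cinner_sum_right: "cinner (y::'a::complex_inner) (sum f F) = (\<Sum>i\<in>F. cinner y (f i))"
  by (induction F rule: infinite_finite_induct) (simp_all add: cinner_add_right)

lemma cinner_self: "cinner x x = complex_of_real ((norm (x::'a::complex_inner))\<^sup>2)"
proof -
  from cinner_self_nonneg[of x] obtain r where r: "cinner x x = complex_of_real r" "r \<ge> 0"
    by (auto simp: nonneg_Reals_def)
  then show ?thesis
    by (simp add: norm_eq_sqrt_cinner)
qed

lemma orthonormalD:
  assumes "orthonormal E" "e \<in> E" "f \<in> E"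
  shows "cinner e f = (if e = f then 1 else 0)"
  using assms by (auto simp: orthonormal_def cinner_self)

lemma norm_orthonormal_sum:
  assumes "orthonormal E" "finite F" "F \<subseteq> E"
  shows "(norm (\<Sum>e\<in>F. c e *\<^sub>C e))\<^sup>2 = (\<Sum>e\<in>F. (cmod (c e))\<^sup>2)"
proof -
  have "complex_of_real ((norm (\<Sum>e\<in>F. c e *\<^sub>C e))\<^sup>2)
      = (\<Sum>f\<in>F. \<Sum>e\<in>F. c e * cnj (c f) * (if e = f then 1 else 0))"
    unfolding cinner_self[symmetric] cinner_sum_left cinner_sum_right
    by (subst sum.swap)
      (intro sum.cong refl, use assms in \<open>auto simp: cinner_scaleC_left cinner_scaleC_right
        orthonormalD[OF assms(1)] subset_iff\<close>)
  also have "\<dots> = (\<Sum>f\<in>F. c f * cnj (c f))"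
    using assms(2) by (intro sum.cong refl) (simp add: if_distrib cong: if_cong)
  also have "\<dots> = complex_of_real (\<Sum>e\<in>F. (cmod (c e))\<^sup>2)"
    by (simp add: complex_norm_square[symmetric] del: of_real_power)
  finally show ?thesis
    by (simp only: of_real_eq_iff)
qed

lemma bessel:
  assumes "orthonormal E" "finite F" "F \<subseteq> E"
  shows "(\<Sum>e\<in>F. (cmod (cinner x e))\<^sup>2) \<le> (norm x)\<^sup>2"
proof -
  define p where "p = (\<Sum>e\<in>F. cinner x e *\<^sub>C e)"
  have xp: "cinner x p = complex_of_real (\<Sum>e\<in>F. (cmod (cinner x e))\<^sup>2)"
    by (simp add: p_def cinner_sum_right cinner_scaleC_right complex_norm_square mult.commute
        del: of_real_power)
  have pp: "cinner p p = complex_of_real (\<Sum>e\<in>F. (cmod (cinner x e))\<^sup>2)"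
    unfolding cinner_self p_def norm_orthonormal_sum[OF assms] ..
  have px: "cinner p x = complex_of_real (\<Sum>e\<in>F. (cmod (cinner x e))\<^sup>2)"
    using cinner_commute[of p x] xp by simp
  have "complex_of_real ((norm (x - p))\<^sup>2)
      = complex_of_real ((norm x)\<^sup>2 - (\<Sum>e\<in>F. (cmod (cinner x e))\<^sup>2))"
    unfolding cinner_self[symmetric] cinner_diff_left cinner_diff_right xp px pp
    by (simp add: cinner_self)
  then have "(norm (x - p))\<^sup>2 = (norm x)\<^sup>2 - (\<Sum>e\<in>F. (cmod (cinner x e))\<^sup>2)"
    by (simp only: of_real_eq_iff)
  then show ?thesis
    by (smt (verit) zero_le_power2)
qed

lemma cmod_cinner_le: "cmod (cinner x (y::'a::complex_inner)) \<le> norm x * norm y"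
proof (cases "y = 0")
  case False
  define u where "u = complex_of_real (inverse (norm y)) *\<^sub>C y"
  have u: "norm u = 1"
    using False by (simp add: u_def norm_scaleC norm_inverse)
  have "(\<Sum>e\<in>{u}. (cmod (cinner x e))\<^sup>2) \<le> (norm x)\<^sup>2"
    by (rule bessel[where E = "{u}"]) (auto simp: orthonormal_def u)
  then have "cmod (cinner x u) \<le> norm x"
    by (simp add: power2_le_iff_abs_le)
  moreover have "cmod (cinner x u) = cmod (cinner x y) / norm y"
    by (simp add: u_def cinner_scaleC_right norm_mult norm_inverse divide_inverse mult.commute)
  ultimately show ?thesis
    using False by (simp add: field_simps)
qed simp

lemma bounded_linear_cinner_left: "bounded_linear (\<lambda>x. cinner x (y::'a::complex_inner))"
  by (rule bounded_linear_intro[where K = "norm y"])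
    (auto simp: cinner_add_left scaleR_scaleC cinner_scaleC_left cmod_cinner_le scaleC_complex_def)

lemma orthonormal_expansion_summable:
  fixes E :: "'h::chilbert_space set"
  assumes "orthonormal E"
  shows "(\<lambda>e. cinner x e *\<^sub>C e) summable_on E"
proof -
  let ?f = "\<lambda>e. cinner x e *\<^sub>C e" and ?g = "\<lambda>e. (cmod (cinner x e))\<^sup>2"
  have sg: "?g summable_on E"
    by (rule nonneg_bdd_above_summable_on)
      (use bessel[OF assms] in \<open>auto intro!: bdd_aboveI[where M = "(norm x)\<^sup>2"]\<close>)
  then obtain L where lim: "(sum ?g \<longlongrightarrow> L) (finite_subsets_at_top E)"
    unfolding has_sum_def summable_on_def by blast
  have "\<exists>P. eventually P (finite_subsets_at_top E) \<and>
              (\<forall>F F'. P F \<and> P F' \<longrightarrow> dist (sum ?f F) (sum ?f F') < d)" if "d > 0" for d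
  proof -
    define r where "r = (d / 2)\<^sup>2 / 2"
    have "r > 0" using that by (simp add: r_def)
    then have "eventually (\<lambda>F. dist (sum ?g F) L < r) (finite_subsets_at_top E)"
      by (rule tendstoD[OF lim])
    then obtain F0 where F0: "finite F0" "F0 \<subseteq> E"
      and near: "\<And>F. finite F \<Longrightarrow> F0 \<subseteq> F \<Longrightarrow> F \<subseteq> E \<Longrightarrow> dist (sum ?g F) L < r"
      unfolding eventually_finite_subsets_at_top by metis
    have close: "dist (sum ?f F) (sum ?f F0) < d / 2"
      if F: "finite F" "F0 \<subseteq> F" "F \<subseteq> E" for F
    proof -
      have "(dist (sum ?f F) (sum ?f F0))\<^sup>2 = (norm (sum ?f (F - F0)))\<^sup>2"
        unfolding dist_norm using F by (subst sum_diff) auto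
      also have "\<dots> = sum ?g (F - F0)"
        using F by (intro norm_orthonormal_sum[OF assms]) auto
      also have "\<dots> = sum ?g F - sum ?g F0"
        using F by (subst sum_diff) auto
      also have "\<dots> < 2 * r"
        using near[OF F] near[OF F0(1) subset_refl F0(2)] by (simp add: dist_real_def)
      also have "2 * r = (d / 2)\<^sup>2"
        by (simp add: r_def)
      finally show ?thesis
        using that \<open>d > 0\<close> by (meson less_eq_real_def half_gt_zero power_less_imp_less_base)
    qed
    have "eventually (\<lambda>F. finite F \<and> F0 \<subseteq> F \<and> F \<subseteq> E) (finite_subsets_at_top E)"
      unfolding eventually_finite_subsets_at_top using F0 by blast
    moreover have "dist (sum ?f F) (sum ?f F') < d"
      if "finite F \<and> F0 \<subseteq> F \<and> F \<subseteq> E" "finite F' \<and> F0 \<subseteq> F' \<and> F' \<subseteq> E" for F F'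
      using close[of F] close[of F'] that dist_triangle2[of "sum ?f F" "sum ?f F'" "sum ?f F0"]
      by simp
    ultimately show ?thesis
      by (intro exI[of _ "\<lambda>F. finite F \<and> F0 \<subseteq> F \<and> F \<subseteq> E"] conjI allI impI) auto
  qed
  then have "cauchy_filter (filtermap (sum ?f) (finite_subsets_at_top E))"
    by (intro cauchy_filter_metric_filtermap[THEN iffD2] allI impI)
  moreover have "complete (UNIV::'h set)"
    by (meson Cauchy_convergent UNIV_I complete_def convergent_def)
  ultimately obtain L' where "(sum ?f \<longlongrightarrow> L') (finite_subsets_at_top E)"
    using complete_uniform[where S=UNIV] by (force simp add: filterlim_def)
  then show ?thesis
    using summable_on_def has_sum_def by blast
qed

lemma maximal_orthonormal_is_onb:
  fixes E :: "'h::chilbert_space set"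
  assumes E: "orthonormal E" and max: "\<And>E'. orthonormal E' \<Longrightarrow> E \<subseteq> E' \<Longrightarrow> E' = E"
  shows "is_onb E"
proof -
  have "x \<in> closure (cspan E)" for x
  proof -
    let ?f = "\<lambda>e. cinner x e *\<^sub>C e"
    define p where "p = infsum ?f E"
    have p: "(?f has_sum p) E"
      unfolding p_def by (intro has_sum_infsum orthonormal_expansion_summable E)
    have orth: "cinner (x - p) e = 0" if "e \<in> E" for e
    proof -
      have "((\<lambda>e'. cinner (?f e') e) has_sum cinner p e) E"
        by (rule has_sum_bounded_linear[OF bounded_linear_cinner_left p])
      moreover have "((\<lambda>e'. cinner (?f e') e) has_sum cinner x e) E
          \<longleftrightarrow> ((\<lambda>e'. cinner x e) has_sum cinner x e) {e}"
        using that by (intro has_sum_cong_neutral)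
          (auto simp: cinner_scaleC_left orthonormalD[OF E])
      moreover have "((\<lambda>e'. cinner x e) has_sum cinner x e) {e}"
        using has_sum_finite[of "{e}" "\<lambda>e'. cinner x e"] by simp
      ultimately have "cinner p e = cinner x e"
        using has_sum_unique by blast
      then show ?thesis by (simp add: cinner_diff_left)
    qed
    have "x = p"
    proof (rule ccontr)
      assume "x \<noteq> p"
      define u where "u = complex_of_real (inverse (norm (x - p))) *\<^sub>C (x - p)"
      have u: "norm u = 1"
        using \<open>x \<noteq> p\<close> by (simp add: u_def norm_scaleC norm_inverse)
      have u0: "cinner u e = 0" "cinner e u = 0" if "e \<in> E" for e
        using orth[OF that] cinner_commute[of e u] by (auto simp: u_def cinner_scaleC_left)
      have "orthonormal (insert u E)"
        using E u u0 by (auto simp: orthonormal_def)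
      then have "u \<in> E"
        using max[of "insert u E"] by blast
      then have "cinner u u = 0" using u0 by blast
      then show False using u by (simp add: cinner_self)
    qed
    have "(sum ?f \<longlongrightarrow> x) (finite_subsets_at_top E)"
      using p \<open>x = p\<close> by (simp add: has_sum_def)
    moreover have "\<forall>\<^sub>F F in finite_subsets_at_top E. sum ?f F \<in> closure (cspan E)"
    proof (rule eventually_finite_subsets_at_top_weakI)
      fix F assume "finite F" "F \<subseteq> E"
      then have "sum ?f F \<in> cspan E"
        by (intro complex_vector.span_sum complex_vector.span_scale complex_vector.span_base) auto
      then show "sum ?f F \<in> closure (cspan E)"
        using closure_subset by blast
    qed
    ultimately show ?thesis
      by (intro Lim_in_closed_set[of "closure (cspan E)"]) auto
  qed
  then show ?thesis
    using E by (auto simp: is_onb_def)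
qed

lemma is_onb_some_onb: "is_onb (some_onb :: 'h::chilbert_space set)"
proof -
  have "\<exists>M\<in>{E::'h set. orthonormal E}. \<forall>X\<in>{E. orthonormal E}. M \<subseteq> X \<longrightarrow> X = M"
  proof (rule subset_Zorn_nonempty)
    show "{E::'h set. orthonormal E} \<noteq> {}"
      by (auto simp: orthonormal_def intro: exI[of _ "{}"])
  next
    fix C assume C: "C \<noteq> {}" "subset.chain {E::'h set. orthonormal E} C"
    have "cinner e f = 0" if "X \<in> C" "e \<in> X" "Y \<in> C" "f \<in> Y" "e \<noteq> f" for e f X Y
    proof -
      have "X \<subseteq> Y \<or> Y \<subseteq> X" "orthonormal X" "orthonormal Y"
        using C that by (auto simp: subset_chain_def)
      then show ?thesis
        using that unfolding orthonormal_def by blast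
    qed
    moreover have "norm e = 1" if "X \<in> C" "e \<in> X" for e X
      using C that by (auto simp: subset_chain_def orthonormal_def)
    ultimately show "\<Union>C \<in> {E. orthonormal E}"
      by (auto simp: orthonormal_def)
  qed
  then obtain M :: "'h set" where "orthonormal M" "\<And>X. orthonormal X \<Longrightarrow> M \<subseteq> X \<Longrightarrow> X = M"
    by blast
  then have "is_onb M"
    by (rule maximal_orthonormal_is_onb)
  then show ?thesis
    unfolding some_onb_def by (rule someI)
qed

section \<open>Hilbert--Schmidt operators\<close>

text \<open>
  Neither square summability nor the value of the sum depends on the orthonormal basis.
\<close>
definition is_hilbert_schmidt :: "('h::chilbert_space \<Rightarrow>\<^sub>L 'h) \<Rightarrow> bool"
  where "is_hilbert_schmidt A \<longleftrightarrow>
    complex_linear A \<and> (\<lambda>e. (norm (A e))\<^sup>2) summable_on some_onb"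

lemma is_hilbert_schmidt_add:
  assumes "is_hilbert_schmidt A" "is_hilbert_schmidt B"
  shows "is_hilbert_schmidt (A + B)"
proof -
  have "(\<lambda>e. (norm ((A + B) e))\<^sup>2) summable_on some_onb"
  proof (rule summable_on_comparison_test)
    show "(\<lambda>e. 2 * (norm (A e))\<^sup>2 + 2 * (norm (B e))\<^sup>2) summable_on some_onb"
      using assms by (intro summable_on_add summable_on_cmult_right) (auto simp: is_hilbert_schmidt_def)
    show "(norm ((A + B) e))\<^sup>2 \<le> 2 * (norm (A e))\<^sup>2 + 2 * (norm (B e))\<^sup>2" for e
    proof -
      have "(norm ((A + B) e))\<^sup>2 \<le> (norm (A e) + norm (B e))\<^sup>2"
        by (simp add: blinfun.add_left norm_triangle_ineq power_mono)
      also have "\<dots> \<le> 2 * (norm (A e))\<^sup>2 + 2 * (norm (B e))\<^sup>2"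
        using sum_squares_bound[of "norm (A e)" "norm (B e)"] by (simp add: power2_sum)
      finally show ?thesis .
    qed
  qed simp
  then show ?thesis
    using assms by (simp add: is_hilbert_schmidt_def complex_linear_def blinfun.add_left scaleC_add_right)
qed

lemma bounded_linear_scaleC: "bounded_linear (\<lambda>x. c *\<^sub>C (x::'a::complex_normed_vector))"
  by (rule bounded_linear_intro[where K = "cmod c"])
    (auto simp: scaleC_add_right scaleR_scaleC scaleC_scaleC norm_scaleC mult.commute)

definition blinfun_scaleC :: "complex \<Rightarrow> ('a::real_normed_vector \<Rightarrow>\<^sub>L 'b::complex_normed_vector) \<Rightarrow> 'a \<Rightarrow>\<^sub>L 'b"
  where "blinfun_scaleC c A = Blinfun (\<lambda>x. c *\<^sub>C A x)"

lemma blinfun_scaleC_apply [simp]: "blinfun_scaleC c A x = c *\<^sub>C A x"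
  unfolding blinfun_scaleC_def
  by (subst bounded_linear_Blinfun_apply)
    (auto intro: bounded_linear_compose[OF bounded_linear_scaleC] blinfun.bounded_linear_right)

lemma is_hilbert_schmidt_scaleC:
  assumes "is_hilbert_schmidt A"
  shows "is_hilbert_schmidt (blinfun_scaleC c A)"
proof -
  have "(\<lambda>e. (cmod c)\<^sup>2 * (norm (A e))\<^sup>2) summable_on some_onb"
    using assms by (intro summable_on_cmult_right) (simp add: is_hilbert_schmidt_def)
  moreover have "complex_linear (blinfun_scaleC c A)"
    using assms by (simp add: is_hilbert_schmidt_def complex_linear_def scaleC_scaleC mult.commute)
  ultimately show ?thesis
    by (simp add: is_hilbert_schmidt_def norm_scaleC power_mult_distrib)
qed

lemma is_hilbert_schmidt_0: "is_hilbert_schmidt 0"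
  by (simp add: is_hilbert_schmidt_def complex_linear_def)

lemma blinfun_scaleR_eq: "r *\<^sub>R A = blinfun_scaleC (complex_of_real r) A"
  by (rule blinfun_eqI) (simp add: blinfun.scaleR_left scaleR_scaleC)

lemma is_hilbert_schmidt_scaleR: "is_hilbert_schmidt A \<Longrightarrow> is_hilbert_schmidt (r *\<^sub>R A)"
  unfolding blinfun_scaleR_eq by (rule is_hilbert_schmidt_scaleC)

lemma is_hilbert_schmidt_uminus: "is_hilbert_schmidt A \<Longrightarrow> is_hilbert_schmidt (- A)"
  using is_hilbert_schmidt_scaleR[of A "- 1"] by simp

lemma is_hilbert_schmidt_diff:
  "is_hilbert_schmidt A \<Longrightarrow> is_hilbert_schmidt B \<Longrightarrow> is_hilbert_schmidt (A - B)"
  using is_hilbert_schmidt_add[of A "- B"] is_hilbert_schmidt_uminus[of B] by simp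

definition hs_norm :: "('h::chilbert_space \<Rightarrow>\<^sub>L 'h) \<Rightarrow> real"
  where "hs_norm A = sqrt (\<Sum>\<^sub>\<infinity>e\<in>some_onb. (norm (A e))\<^sup>2)"

lemma hs_norm_nonneg: "hs_norm A \<ge> 0"
  by (simp add: hs_norm_def infsum_nonneg)

lemma L2_set_le_hs_norm:
  assumes "is_hilbert_schmidt A" "finite F" "F \<subseteq> some_onb"
  shows "L2_set (\<lambda>e. norm (A e)) F \<le> hs_norm A"
  unfolding L2_set_def hs_norm_def
  using assms by (intro real_sqrt_le_mono finite_sum_le_infsum) (auto simp: is_hilbert_schmidt_def)

lemma hs_norm_triangle:
  assumes A: "is_hilbert_schmidt A" and B: "is_hilbert_schmidt B"
  shows "hs_norm (A + B) \<le> hs_norm A + hs_norm B"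
proof -
  have "(\<Sum>\<^sub>\<infinity>e\<in>some_onb. (norm ((A + B) e))\<^sup>2) \<le> (hs_norm A + hs_norm B)\<^sup>2"
  proof (rule infsum_le_finite_sums)
    show "(\<lambda>e. (norm ((A + B) e))\<^sup>2) summable_on some_onb"
      using is_hilbert_schmidt_add[OF A B] by (simp add: is_hilbert_schmidt_def)
    fix F :: "'a set" assume F: "finite F" "F \<subseteq> some_onb"
    have "L2_set (\<lambda>e. norm ((A + B) e)) F \<le> L2_set (\<lambda>e. norm (A e) + norm (B e)) F"
      by (intro L2_set_mono) (auto simp: blinfun.add_left norm_triangle_ineq)
    also have "\<dots> \<le> L2_set (\<lambda>e. norm (A e)) F + L2_set (\<lambda>e. norm (B e)) F"
      by (rule L2_set_triangle_ineq)
    also have "\<dots> \<le> hs_norm A + hs_norm B"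
      by (intro add_mono L2_set_le_hs_norm A B F)
    finally have "(L2_set (\<lambda>e. norm ((A + B) e)) F)\<^sup>2 \<le> (hs_norm A + hs_norm B)\<^sup>2"
      by (intro power_mono) (auto simp: L2_set_nonneg)
    then show "(\<Sum>e\<in>F. (norm ((A + B) e))\<^sup>2) \<le> (hs_norm A + hs_norm B)\<^sup>2"
      by (simp add: L2_set_def sum_nonneg)
  qed
  then show ?thesis
    unfolding hs_norm_def[of "A + B"]
    by (intro real_le_lsqrt add_nonneg_nonneg hs_norm_nonneg)
      (auto intro: infsum_nonneg)
qed

lemma hs_norm_scaleC: "hs_norm (blinfun_scaleC c A) = cmod c * hs_norm A"
  by (simp add: hs_norm_def norm_scaleC power_mult_distrib infsum_cmult_right' real_sqrt_mult)

lemma hs_norm_eq_0: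
  assumes A: "is_hilbert_schmidt A" and 0: "hs_norm A = 0"
  shows "A = 0"
proof (rule blinfun_eqI)
  fix x
  have E: "is_onb (some_onb :: 'a set)" by (rule is_onb_some_onb)
  have base: "A e = 0" if "e \<in> some_onb" for e
    using L2_set_le_hs_norm[OF A, of "{e}"] that 0 by simp
  have "cspan some_onb \<subseteq> {x. A x = 0}"
  proof (rule complex_vector.span_minimal)
    show "some_onb \<subseteq> {x. A x = 0}" using base by blast
    show "complex_vector.subspace {x. A x = 0}"
      using A by (auto simp: complex_vector.subspace_def is_hilbert_schmidt_def complex_linear_def
          blinfun.add_right)
  qed
  then have "closure (cspan some_onb) \<subseteq> {x. A x = 0}"
    by (intro closure_minimal closed_Collect_eq continuous_intros)
  then show "A x = (0 :: 'a \<Rightarrow>\<^sub>L 'a) x"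
    using E by (auto simp: is_onb_def)
qed

typedef (overloaded) 'h hilbert_schmidt = "{A :: 'h::chilbert_space \<Rightarrow>\<^sub>L 'h. is_hilbert_schmidt A}"
  morphisms hs_op Abs_hilbert_schmidt
  using is_hilbert_schmidt_0 by blast

setup_lifting type_definition_hilbert_schmidt

instantiation hilbert_schmidt :: (chilbert_space) complex_normed_vector
begin

lift_definition zero_hilbert_schmidt :: "'a hilbert_schmidt" is 0
  by (rule is_hilbert_schmidt_0)

lift_definition plus_hilbert_schmidt ::
  "'a hilbert_schmidt \<Rightarrow> 'a hilbert_schmidt \<Rightarrow> 'a hilbert_schmidt" is "(+)"
  by (rule is_hilbert_schmidt_add)

lift_definition minus_hilbert_schmidt ::
  "'a hilbert_schmidt \<Rightarrow> 'a hilbert_schmidt \<Rightarrow> 'a hilbert_schmidt" is "(-)"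
  by (rule is_hilbert_schmidt_diff)

lift_definition uminus_hilbert_schmidt :: "'a hilbert_schmidt \<Rightarrow> 'a hilbert_schmidt" is uminus
  by (rule is_hilbert_schmidt_uminus)

lift_definition scaleR_hilbert_schmidt :: "real \<Rightarrow> 'a hilbert_schmidt \<Rightarrow> 'a hilbert_schmidt"
  is scaleR
  by (rule is_hilbert_schmidt_scaleR)

lift_definition scaleC_hilbert_schmidt :: "complex \<Rightarrow> 'a hilbert_schmidt \<Rightarrow> 'a hilbert_schmidt"
  is blinfun_scaleC
  by (rule is_hilbert_schmidt_scaleC)

lift_definition norm_hilbert_schmidt :: "'a hilbert_schmidt \<Rightarrow> real" is hs_norm .

definition dist_hilbert_schmidt :: "'a hilbert_schmidt \<Rightarrow> 'a hilbert_schmidt \<Rightarrow> real"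
  where "dist_hilbert_schmidt A B = norm (A - B)"

definition sgn_hilbert_schmidt :: "'a hilbert_schmidt \<Rightarrow> 'a hilbert_schmidt"
  where "sgn_hilbert_schmidt A = scaleR (inverse (norm A)) A"

definition uniformity_hilbert_schmidt :: "('a hilbert_schmidt \<times> 'a hilbert_schmidt) filter"
  where "uniformity_hilbert_schmidt = (INF e\<in>{0 <..}. principal {(x, y). dist x y < e})"

definition open_hilbert_schmidt :: "'a hilbert_schmidt set \<Rightarrow> bool"
  where "open_hilbert_schmidt S = (\<forall>x\<in>S. \<forall>\<^sub>F (x', y) in uniformity. x' = x \<longrightarrow> y \<in> S)"

instance
proof
  fix A B C :: "'a hilbert_schmidt" and a b :: complex and r s :: real
  show "A + B + C = A + (B + C)" by transfer (simp add: add.assoc)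
  show "A + B = B + A" by transfer (simp add: add.commute)
  show "0 + A = A" by transfer simp
  show "- A + A = 0" by transfer simp
  show "A - B = A + - B" by transfer simp
  show "r *\<^sub>R (A + B) = r *\<^sub>R A + r *\<^sub>R B" by transfer (simp add: scaleR_add_right)
  show "(r + s) *\<^sub>R A = r *\<^sub>R A + s *\<^sub>R A" by transfer (simp add: scaleR_add_left)
  show "r *\<^sub>R s *\<^sub>R A = (r * s) *\<^sub>R A" by transfer simp
  show "1 *\<^sub>R A = A" by transfer simp
  show "a *\<^sub>C (A + B) = a *\<^sub>C A + a *\<^sub>C B"
    by transfer (auto intro!: blinfun_eqI simp: blinfun.add_left scaleC_add_right)
  show "(a + b) *\<^sub>C A = a *\<^sub>C A + b *\<^sub>C A"
    by transfer (auto intro!: blinfun_eqI simp: blinfun.add_left scaleC_add_left)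
  show "a *\<^sub>C b *\<^sub>C A = (a * b) *\<^sub>C A"
    by transfer (auto intro!: blinfun_eqI simp: scaleC_scaleC)
  show "1 *\<^sub>C A = A"
    by transfer (auto intro!: blinfun_eqI simp: scaleC_one)
  show "r *\<^sub>R A = complex_of_real r *\<^sub>C A"
    by transfer (rule blinfun_scaleR_eq)
  show "dist A B = norm (A - B)" by (rule dist_hilbert_schmidt_def)
  show "sgn A = inverse (norm A) *\<^sub>R A" by (rule sgn_hilbert_schmidt_def)
  show "uniformity = (INF e\<in>{0 <..}. principal {(x, y :: 'a hilbert_schmidt). dist x y < e})"
    by (rule uniformity_hilbert_schmidt_def)
  show "open S = (\<forall>x\<in>S. \<forall>\<^sub>F (x', y) in uniformity. x' = x \<longrightarrow> y \<in> S)"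
    for S :: "'a hilbert_schmidt set"
    by (rule open_hilbert_schmidt_def)
  show "norm A = 0 \<longleftrightarrow> A = 0"
    by transfer (auto dest: hs_norm_eq_0 simp: hs_norm_def)
  show "norm (A + B) \<le> norm A + norm B"
    by transfer (rule hs_norm_triangle)
  show "norm (r *\<^sub>R A) = \<bar>r\<bar> * norm A"
    by transfer (simp add: blinfun_scaleR_eq hs_norm_scaleC)
  show "norm (a *\<^sub>C A) = cmod a * norm A"
    by transfer (rule hs_norm_scaleC)
qed

end

section \<open>Trace class operators\<close>

definition adj :: "('h::chilbert_space \<Rightarrow>\<^sub>L 'h) \<Rightarrow> 'h \<Rightarrow>\<^sub>L 'h"
  where "adj A = (THE B :: 'h \<Rightarrow>\<^sub>L 'h. \<forall>x y. cinner (A x) y = cinner x (B y))"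

definition positive_op :: "('h::chilbert_space \<Rightarrow>\<^sub>L 'h) \<Rightarrow> bool"
  where "positive_op P \<longleftrightarrow> complex_linear P \<and> (\<forall>x. cinner (P x) x \<in> \<real>\<^sub>\<ge>\<^sub>0)"

text \<open>The modulus of \<open>A\<close> is the unique positive square root of the product of \<open>A\<close>'s adjoint with \<open>A\<close>.\<close>
definition abs_op :: "('h::chilbert_space \<Rightarrow>\<^sub>L 'h) \<Rightarrow> 'h \<Rightarrow>\<^sub>L 'h"
  where "abs_op A = (THE P. positive_op P \<and> P o\<^sub>L P = adj A o\<^sub>L A)"

text \<open>
  The trace norm is the trace of the modulus, with value \<open>\<infinity>\<close> when \<open>A\<close> is not of trace class;
  it does not depend on the orthonormal basis.
\<close>
definition trace_norm :: "('h::chilbert_space \<Rightarrow>\<^sub>L 'h) \<Rightarrow> ennreal"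
  where "trace_norm A = (\<Sum>\<^sub>\<infinity>e\<in>some_onb. ennreal (Re (cinner (abs_op A e) e)))"

definition trace_class :: "('h::chilbert_space \<Rightarrow>\<^sub>L 'h) set"
  where "trace_class = {A. complex_linear A \<and> trace_norm A < \<infinity>}"

definition trace_norm_open :: "('h::chilbert_space \<Rightarrow>\<^sub>L 'h) set \<Rightarrow> bool"
  where "trace_norm_open U \<longleftrightarrow> U \<subseteq> trace_class \<and>
    (\<forall>A\<in>U. \<exists>\<epsilon>>0. \<forall>B\<in>trace_class. trace_norm (B - A) < ennreal \<epsilon> \<longrightarrow> B \<in> U)"

section \<open>Numerical hypercyclicity and transitivity\<close>

text \<open>
  Pairs carry the product topology, which is the one induced by the maximum of the norms.
\<close>
definition norming_pairs :: "('a::complex_normed_vector \<times> ('a \<Rightarrow>\<^sub>L complex)) set"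
  where "norming_pairs = {(x, f). norm x = 1 \<and> complex_linear f \<and> norm f = 1 \<and> f x = 1}"

definition numerically_hypercyclic :: "('a::complex_normed_vector \<Rightarrow>\<^sub>L 'a) \<Rightarrow> bool"
  where "numerically_hypercyclic T \<longleftrightarrow>
    (\<exists>(x, f)\<in>norming_pairs. closure (range (\<lambda>n. blinfun_apply f ((blinfun_apply T ^^ n) x))) = UNIV)"

definition topologically_numerically_transitive :: "('a::complex_normed_vector \<Rightarrow>\<^sub>L 'a) \<Rightarrow> bool"
  where "topologically_numerically_transitive T \<longleftrightarrow>
    (\<forall>U V. openin (top_of_set norming_pairs) U \<and> U \<noteq> {} \<and> open V \<and> V \<noteq> {} \<longrightarrow>
      (\<exists>n. \<exists>(x, f)\<in>U. blinfun_apply f ((blinfun_apply T ^^ n) x) \<in> V))"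

section \<open>C*-transitivity\<close>

definition topologically_cstar_transitive ::
  "('h::chilbert_space hilbert_schmidt \<Rightarrow>\<^sub>L 'h hilbert_schmidt) \<Rightarrow> bool"
  where "topologically_cstar_transitive T \<longleftrightarrow>
    (\<forall>W U. openin (top_of_set (sphere 0 1 \<times> sphere 0 1)) W \<and> W \<noteq> {} \<and>
        trace_norm_open U \<and> U \<noteq> {} \<longrightarrow>
      (\<exists>n. \<exists>(A, B)\<in>W. adj (hs_op B) o\<^sub>L hs_op ((blinfun_apply T ^^ n) A) \<in> U))"

end

theory Submission
  imports Defs
begin

text \<open>
  Let \<open>e\<^sub>0, e\<^sub>1, \<dots>\<close> be an orthonormal basis and let \<open>T\<close> be right multiplication by four times the
  backward shift, so that \<open>(T A) e\<^sub>0 = 0\<close> and \<open>(T A) e\<^bsub>k+1\<^esub> = 4 A e\<^sub>k\<close>. Then \<open>B\<^sup>*T\<^sup>n(A) e\<^sub>0\<close> has norm at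
  most \<open>1\<close> for all unit vectors \<open>A\<close>, \<open>B\<close> and all \<open>n\<close>, while \<open>\<parallel>C e\<^sub>0\<parallel> > 1\<close> defines a nonempty
  open set of trace class operators because the trace norm dominates \<open>\<parallel>C e\<^sub>0\<parallel>\<close>; so \<open>T\<close> is not
  topologically C*-transitive. On the other hand, \<open>B\<^sub>2(H)\<close> is a Hilbert space, a unit vector \<open>A\<close> has
  the unique norming functional \<open>\<langle>\<cdot>, A\<rangle>\<close>, and any \<open>A\<close> can be perturbed in sparse far columns by
  arbitrarily small amounts that prescribe \<open>\<langle>T\<^sup>n A, A\<rangle>\<close> at infinitely many \<open>n\<close>. So the unit vectors
  with a dense numerical orbit are dense in the unit sphere.
\<close>

section \<open>Riesz representation and adjoints\<close>

text \<open>Completeness is part of the class. As a \<open>banach\<close> type it lets absolutely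
  convergent series of vectors and of operators converge, as the column series and the square root
  iteration require.\<close>

instance chilbert_space \<subseteq> banach ..

interpretation blinfun_compose: bounded_bilinear "(o\<^sub>L) :: ('b::real_normed_vector \<Rightarrow>\<^sub>L 'c::real_normed_vector) \<Rightarrow> ('a::real_normed_vector \<Rightarrow>\<^sub>L 'b) \<Rightarrow> _"
  by (rule bounded_bilinear_blinfun_compose)

lemma cinner_ext:
  fixes u v :: "'a::complex_inner"
  assumes "\<And>x. cinner x u = cinner x v"
  shows "u = v"
proof -
  have "cinner (u - v) (u - v) = 0"
    by (simp add: cinner_diff_right assms)
  then show ?thesis
    by (simp add: cinner_self)
qed

lemma norm_add_square:
  fixes x y :: "'a::complex_inner"
  shows "(norm (x + y))\<^sup>2 = (norm x)\<^sup>2 + 2 * Re (cinner x y) + (norm y)\<^sup>2"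
proof -
  have "Re (cinner (x + y) (x + y)) = Re (cinner x x) + 2 * Re (cinner x y) + Re (cinner y y)"
    using cinner_commute[of y x] by (simp add: cinner_add_left cinner_add_right)
  then show ?thesis
    by (simp add: cinner_self)
qed

lemma parallelogram:
  fixes x y :: "'a::complex_inner"
  shows "(norm (x - y))\<^sup>2 = 2 * (norm x)\<^sup>2 + 2 * (norm y)\<^sup>2 - (norm (x + y))\<^sup>2"
  using norm_add_square[of x y] norm_add_square[of x "- y"] by (simp add: cinner_minus_right)

text \<open>Cauchy-Schwarz bounds the pairing of \<open>x\<close> with a finite combination of basis
  vectors by \<open>M\<close> times the norm of that combination. Density extends this to every
  vector, and pairing \<open>x\<close> with itself gives the claim.\<close>

lemma norm_le_of_coefficients:
  assumes E: "is_onb E" and M: "0 \<le> M"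
    and le: "\<And>F. finite F \<Longrightarrow> F \<subseteq> E \<Longrightarrow> (\<Sum>e\<in>F. (cmod (cinner x e))\<^sup>2) \<le> M\<^sup>2"
  shows "norm x \<le> M"
proof -
  have "cmod (cinner x z) \<le> M * norm z" if "z \<in> cspan E" for z
  proof -
    from that obtain F c where F: "finite F" "F \<subseteq> E" and z: "z = (\<Sum>e\<in>F. c e *\<^sub>C e)"
      unfolding complex_vector.span_explicit by blast
    have "cmod (cinner x z) \<le> (\<Sum>e\<in>F. \<bar>cmod (cinner x e)\<bar> * \<bar>cmod (c e)\<bar>)"
      unfolding z cinner_sum_right
      by (intro order_trans[OF norm_sum] sum_mono) (simp add: cinner_scaleC_right norm_mult)
    also have "\<dots> \<le> L2_set (\<lambda>e. cmod (cinner x e)) F * L2_set (\<lambda>e. cmod (c e)) F"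
      by (rule L2_set_mult_ineq)
    also have "L2_set (\<lambda>e. cmod (c e)) F = norm z"
      unfolding L2_set_def z
      using norm_orthonormal_sum[of E F c] E F by (metis is_onb_def norm_ge_zero real_sqrt_unique)
    also have "L2_set (\<lambda>e. cmod (cinner x e)) F \<le> M"
      unfolding L2_set_def using le[OF F] M by (simp add: real_le_lsqrt)
    finally show ?thesis by (simp add: mult_right_mono)
  qed
  then have "cspan E \<subseteq> {z. cmod (cinner x z) \<le> M * norm z}" by blast
  moreover have "continuous_on UNIV (\<lambda>z. cinner x z)"
  proof -
    have "bounded_linear (\<lambda>z. cnj (cinner z x))"
      by (intro bounded_linear_compose[OF bounded_linear_cnj] bounded_linear_cinner_left)
    then have "continuous_on UNIV (\<lambda>z. cnj (cinner z x))"
      by (rule linear_continuous_on)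
    then show ?thesis
      unfolding cinner_commute[symmetric] .
  qed
  then have "closed {z. cmod (cinner x z) \<le> M * norm z}"
    by (intro closed_Collect_le continuous_intros)
  ultimately have "closure (cspan E) \<subseteq> {z. cmod (cinner x z) \<le> M * norm z}"
    by (rule closure_minimal)
  then have "cmod (cinner x x) \<le> M * norm x"
    using E by (auto simp: is_onb_def)
  then have "norm x * norm x \<le> M * norm x"
    by (simp add: cinner_self power2_eq_square norm_mult)
  then show ?thesis
    using M by (cases "x = 0") auto
qed

text \<open>If \<open>f z\<close> were nonzero for the part \<open>z\<close> of \<open>y\<close>
  orthogonal to \<open>x\<close>, a small step from \<open>x\<close> along a multiple of
  \<open>z\<close> would raise \<open>f\<close> to first order but the norm only to second
  order.\<close>

lemma norming_functional_eq_cinner: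
  fixes f :: "'a::complex_inner \<Rightarrow>\<^sub>L complex"
  assumes f: "complex_linear f" "norm f \<le> 1" and x: "norm x = 1" "f x = 1"
  shows "f y = cinner y x"
proof -
  define z where "z = y - cinner y x *\<^sub>C x"
  have z: "cinner z x = 0"
    by (simp add: z_def cinner_diff_left cinner_scaleC_left cinner_self x)
  define g where "g = (cmod (f z))\<^sup>2"
  define K where "K = (norm z)\<^sup>2"
  have "g = 0"
  proof (rule ccontr)
    assume "g \<noteq> 0"
    then have g: "g > 0" by (simp add: g_def)
    have K: "K \<ge> 0" by (simp add: K_def)
    \<comment> \<open>This step length makes \<open>s * K\<close> at most 1, whereas the norm bound
      on \<open>f\<close> forces it to be at least 2.\<close>
    define s where "s = 1 / (K + 1)"
    have s: "s > 0" using K by (simp add: s_def)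
    let ?w = "(of_real s * cnj (f z)) *\<^sub>C z"
    have "f (x + ?w) = of_real (1 + s * g)"
      using f(1) unfolding complex_linear_def scaleC_complex_def
      by (simp add: blinfun.add_right x g_def complex_norm_square mult_ac del: of_real_power)
    then have "1 + s * g = cmod (f (x + ?w))"
      using s g by (simp add: norm_of_real del: of_real_add of_real_mult)
    also have "\<dots> \<le> norm (x + ?w)"
      using norm_blinfun[of f "x + ?w"] f(2) mult_right_mono[OF f(2), of "norm (x + ?w)"] by simp
    finally have "(1 + s * g)\<^sup>2 \<le> (norm (x + ?w))\<^sup>2"
      using s g by (intro power_mono) auto
    also have "\<dots> = 1 + s\<^sup>2 * g * K"
      using z cinner_commute[of x z]
      by (simp add: norm_add_square x cinner_scaleC_right norm_scaleC norm_mult power_mult_distrib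
          g_def K_def)
    finally have "s * (g * 2) \<le> s * (g * (s * K))"
      using zero_le_power2[of "s * g"] by (simp add: power2_eq_square algebra_simps)
    then have "2 \<le> s * K" using s g by simp
    also have "\<dots> \<le> 1" using K by (simp add: s_def field_simps)
    finally show False by simp
  qed
  then have "f z = 0" by (simp add: g_def)
  then show ?thesis
    using f(1) by (simp add: z_def blinfun.diff_right complex_linear_def scaleC_complex_def x)
qed

lemma norm_almost_attained:
  fixes f :: "'a::complex_normed_vector \<Rightarrow>\<^sub>L complex"
  assumes f: "complex_linear f" and r: "0 \<le> r" "r < norm f"
  shows "\<exists>x. norm x = 1 \<and> f x \<in> \<real> \<and> r \<le> Re (f x)"
proof -
  have "\<not> (\<forall>x. norm (f x) \<le> r * norm x)"
    using norm_blinfun_bound[of r f] r by force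
  then obtain x where x: "r * norm x < norm (f x)"
    by (meson not_le)
  have "x \<noteq> 0" using x by auto
  have fx: "f x \<noteq> 0"
  proof
    assume "f x = 0"
    then show False using x mult_nonneg_nonneg[OF r(1) norm_ge_zero[of x]] by simp
  qed
  \<comment> \<open>The phase of \<open>c\<close> makes the value of \<open>f\<close> real and
    nonnegative, and its modulus normalises \<open>x\<close>.\<close>
  define c where "c = cnj (f x) / of_real (cmod (f x) * norm x)"
  have "f (c *\<^sub>C x) = c * f x"
    using f by (simp add: complex_linear_def scaleC_complex_def)
  also have "\<dots> = of_real (cmod (f x) / norm x)"
    using complex_norm_square[of "f x"] fx \<open>x \<noteq> 0\<close>
    by (simp add: c_def field_simps power2_eq_square)
  finally have "f (c *\<^sub>C x) = of_real (cmod (f x) / norm x)" .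
  moreover have "norm (c *\<^sub>C x) = 1"
    using fx \<open>x \<noteq> 0\<close> by (simp add: c_def norm_scaleC norm_divide norm_mult)
  moreover have "r \<le> cmod (f x) / norm x"
    using x \<open>x \<noteq> 0\<close> by (simp add: field_simps)
  ultimately show ?thesis
    by (intro exI[of _ "c *\<^sub>C x"]) simp
qed

text \<open>
  A sequence of unit vectors on which \<open>f\<close> almost attains its norm is Cauchy by the parallelogram
  law, and a vector at which the norm is attained represents \<open>f\<close> up to a factor.
\<close>
lemma riesz_representation:
  fixes f :: "'h::chilbert_space \<Rightarrow>\<^sub>L complex"
  assumes f: "complex_linear f"
  shows "\<exists>z. \<forall>y. f y = cinner y z"
proof (cases "f = 0")
  case True
  then show ?thesis by (intro exI[of _ 0]) simp
next
  case False
  then have N: "norm f > 0" by simp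
  define a where "a n = inverse (real (Suc n))" for n
  have a: "0 < a n" "a n \<le> 1" for n by (simp_all add: a_def inverse_le_1_iff)
  have "\<exists>x. norm x = 1 \<and> f x \<in> \<real> \<and> (1 - a n) * norm f \<le> Re (f x)" for n
  proof (rule norm_almost_attained[OF f])
    show "0 \<le> (1 - a n) * norm f" using a[of n] by simp
    show "(1 - a n) * norm f < norm f" using a[of n] N by simp
  qed
  then obtain X where X: "\<And>n. norm (X n) = 1" "\<And>n. f (X n) \<in> \<real>"
    "\<And>n. (1 - a n) * norm f \<le> Re (f (X n))"
    by metis
  have close: "(norm (X m - X n))\<^sup>2 \<le> 4 * (a m + a n)" for m n
  proof -
    \<comment> \<open>The value of \<open>f\<close> at the sum is almost \<open>2 * norm f\<close>,
      so the sum of the two unit vectors has norm almost 2; the parallelogram law then leaves little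
      for their difference.\<close>
    have "(2 - a m - a n) * norm f \<le> Re (f (X m + X n))"
      using X(3)[of m] X(3)[of n] by (simp add: blinfun.add_right algebra_simps)
    also have "\<dots> \<le> norm f * norm (X m + X n)"
      using complex_Re_le_cmod norm_blinfun order_trans by blast
    finally have "2 - a m - a n \<le> norm (X m + X n)"
      using N by (simp add: mult.commute)
    then have "(2 - a m - a n)\<^sup>2 \<le> (norm (X m + X n))\<^sup>2"
      using a[of m] a[of n] by (intro power_mono) auto
    moreover have "(2 - a m - a n)\<^sup>2 = 4 - 4 * (a m + a n) + (a m + a n)\<^sup>2"
      by (simp add: power2_eq_square algebra_simps)
    ultimately show ?thesis
      unfolding parallelogram X by (smt (verit) zero_le_power2 one_power2)
  qed
  have a0: "a \<longlonglongrightarrow> 0"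
    unfolding a_def by (rule LIMSEQ_inverse_real_of_nat)
  have "Cauchy X"
  proof (rule CauchyI)
    fix e :: real assume "e > 0"
    then have "eventually (\<lambda>n. a n < e\<^sup>2 / 8) sequentially"
      using a0 by (intro order_tendstoD) auto
    then obtain M where M: "\<And>n. n \<ge> M \<Longrightarrow> a n < e\<^sup>2 / 8"
      by (auto simp: eventually_sequentially)
    have "norm (X m - X n) < e" if "m \<ge> M" "n \<ge> M" for m n
    proof (rule power_less_imp_less_base)
      show "(norm (X m - X n))\<^sup>2 < e\<^sup>2"
        using close[of m n] M[OF that(1)] M[OF that(2)] by simp
    qed (use \<open>e > 0\<close> in simp)
    then show "\<exists>M. \<forall>m\<ge>M. \<forall>n\<ge>M. norm (X m - X n) < e" by blast
  qed
  then obtain x where x: "X \<longlonglongrightarrow> x"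
    using Cauchy_convergent convergent_def by blast
  have nx: "norm x = 1"
    using tendsto_norm[OF x] X(1) by (simp add: LIMSEQ_const_iff)
  have lim: "(\<lambda>n. f (X n)) \<longlonglongrightarrow> f x"
    using x by (intro tendsto_intros)
  have "f x \<in> \<real>"
    by (rule closed_sequentially[OF closed_complex_Reals _ lim]) (rule X(2))
  moreover have "norm f \<le> Re (f x)"
  proof (rule LIMSEQ_le)
    show "(\<lambda>n. (1 - a n) * norm f) \<longlonglongrightarrow> norm f"
      using tendsto_mult[OF tendsto_diff[OF tendsto_const[of 1] a0] tendsto_const[of "norm f"]]
      by simp
    show "(\<lambda>n. Re (f (X n))) \<longlonglongrightarrow> Re (f x)"
      by (rule tendsto_Re[OF lim])
  qed (use X in auto)
  moreover have "cmod (f x) \<le> norm f"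
    using norm_blinfun[of f x] nx by simp
  ultimately have fx: "f x = of_real (norm f)"
    by (smt (verit) complex_Re_le_cmod of_real_Re)
  have "blinfun_apply ((1 / norm f) *\<^sub>R f) y = cinner y x" for y
    by (rule norming_functional_eq_cinner)
      (use f N nx fx in \<open>auto simp: complex_linear_def blinfun.scaleR_left scaleC_complex_def
        scaleR_conv_of_real\<close>)
  then have "f y = of_real (norm f) * cinner y x" for y
    using N by (simp add: blinfun.scaleR_left scaleR_conv_of_real field_simps)
  then show ?thesis
    by (intro exI[of _ "complex_of_real (norm f) *\<^sub>C x"]) (simp add: cinner_scaleC_right)
qed

text \<open>Since \<open>adj\<close> is a definite description, existence and uniqueness are both
  required. Riesz representation supplies the value at each \<open>y\<close>; boundedness comes from
  pairing \<open>A (g x)\<close> with \<open>x\<close>.\<close>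

lemma cinner_adj:
  assumes A: "complex_linear A"
  shows "cinner (A x) y = cinner x (adj A y)"
proof -
  have "\<exists>z. \<forall>x. cinner (A x) y = cinner x z" for y
  proof -
    have bl: "bounded_linear (\<lambda>x. cinner (A x) y)"
      by (intro bounded_linear_compose[OF bounded_linear_cinner_left] blinfun.bounded_linear_right)
    have "complex_linear (Blinfun (\<lambda>x. cinner (A x) y))"
      using A by (simp add: complex_linear_def bounded_linear_Blinfun_apply[OF bl]
          cinner_scaleC_left scaleC_complex_def)
    from riesz_representation[OF this] show ?thesis
      by (simp add: bounded_linear_Blinfun_apply[OF bl])
  qed
  then obtain g where g: "\<And>x y. cinner (A x) y = cinner x (g y)" by metis
  have "bounded_linear g"
  proof (rule bounded_linear_intro[where K = "norm A"])
    show "g (x + y) = g x + g y" for x y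
      by (rule cinner_ext) (simp add: g[symmetric] cinner_add_right)
    show "g (r *\<^sub>R x) = r *\<^sub>R g x" for r x
      by (rule cinner_ext) (simp add: g[symmetric] scaleR_scaleC cinner_scaleC_right)
    show "norm (g x) \<le> norm x * norm A" for x
    proof (cases "g x = 0")
      case False
      have "norm (g x) * norm (g x) = cmod (cinner (A (g x)) x)"
        by (simp add: g cinner_self power2_eq_square norm_mult)
      also have "\<dots> \<le> norm (A (g x)) * norm x"
        by (rule cmod_cinner_le)
      also have "\<dots> \<le> norm (g x) * (norm x * norm A)"
        using mult_right_mono[OF norm_blinfun[of A "g x"], of "norm x"] by (simp add: mult_ac)
      finally show ?thesis using False by simp
    qed simp
  qed
  then have G: "\<forall>x y. cinner (A x) y = cinner x (Blinfun g y)"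
    by (simp add: bounded_linear_Blinfun_apply g)
  moreover have "B = Blinfun g" if "\<forall>x y. cinner (A x) y = cinner x (blinfun_apply B y)" for B
    by (rule blinfun_eqI, rule cinner_ext) (use that G in metis)
  ultimately have "\<forall>x y. cinner (A x) y = cinner x (adj A y)"
    unfolding adj_def by (rule theI)
  then show ?thesis by blast
qed

lemma adj_eqI:
  fixes A B :: "'h::chilbert_space \<Rightarrow>\<^sub>L 'h"
  assumes "\<And>x y. cinner (A x) y = cinner x (B y)"
  shows "adj A = B"
  unfolding adj_def
proof (rule the_equality)
  show "C = B" if "\<forall>x y. cinner (A x) y = cinner x (blinfun_apply C y)" for C
    by (rule blinfun_eqI, rule cinner_ext) (use that assms in metis)
qed (use assms in blast)

section \<open>Positive square roots and the trace norm\<close>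

lemma positive_op_nonneg: "positive_op P \<Longrightarrow> 0 \<le> Re (cinner (P x) x)"
  by (simp add: positive_op_def complex_nonneg_Reals_iff)

text \<open>Polarisation: the form is real at \<open>x + y\<close> and at
  \<open>x + \<i> *\<^sub>C y\<close>, which fixes the imaginary and the real parts of the mixed
  terms.\<close>

lemma positive_op_self_adjoint:
  assumes P: "positive_op P"
  shows "cinner (P x) y = cinner x (P y)"
proof -
  have real: "Im (cinner (P z) z) = 0" for z
    using P by (simp add: positive_op_def complex_nonneg_Reals_iff)
  have l: "P (c *\<^sub>C z) = c *\<^sub>C P z" for c z
    using P by (auto simp: positive_op_def complex_linear_def)
  have "Im (cinner (P x) y) + Im (cinner (P y) x) = 0"
    using real[of "x + y"] real[of x] real[of y]
    by (simp add: blinfun.add_right cinner_add_left cinner_add_right)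
  moreover have "Re (cinner (P x) y) = Re (cinner (P y) x)"
    using real[of "x + \<i> *\<^sub>C y"] real[of x] real[of y]
    by (simp add: blinfun.add_right cinner_add_left cinner_add_right l cinner_scaleC_left
        cinner_scaleC_right)
  ultimately have "cinner (P x) y = cnj (cinner (P y) x)"
    by (simp add: complex_eq_iff)
  then show ?thesis
    using cinner_commute by metis
qed

lemma positive_op_cauchy_schwarz:
  assumes P: "positive_op P"
  shows "(cmod (cinner (P x) y))\<^sup>2 \<le> Re (cinner (P x) x) * Re (cinner (P y) y)"
proof -
  define a b w where "a = Re (cinner (P x) x)" and "b = Re (cinner (P y) y)"
    and "w = cinner (P x) y"
  have l: "P (c *\<^sub>C z) = c *\<^sub>C P z" for c z
    using P by (auto simp: positive_op_def complex_linear_def)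
  have w': "cinner (P y) x = cnj w"
    using positive_op_self_adjoint[OF P, of y x] cinner_commute[of y "P x"] by (simp add: w_def)
  \<comment> \<open>The form is nonnegative along \<open>x + s w y\<close>. The factor
    \<open>w\<close> makes the mixed terms real, leaving a real quadratic in
    \<open>s\<close>.\<close>
  have q: "0 \<le> a + 2 * s * (cmod w)\<^sup>2 + s\<^sup>2 * (cmod w)\<^sup>2 * b" for s
  proof -
    have "0 \<le> Re (cinner (P (x + (of_real s * w) *\<^sub>C y)) (x + (of_real s * w) *\<^sub>C y))"
      by (rule positive_op_nonneg[OF P])
    also have "\<dots> = a + 2 * s * (cmod w)\<^sup>2 + s\<^sup>2 * (cmod w)\<^sup>2 * b"
      using arg_cong[OF complex_norm_square[of w], of Re] P
      by (simp add: blinfun.add_right cinner_add_left cinner_add_right l cinner_scaleC_left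
          cinner_scaleC_right w' w_def[symmetric] a_def[symmetric] b_def[symmetric] cmod_power2
          algebra_simps power2_eq_square)
    finally show ?thesis .
  qed
  have "0 \<le> b" unfolding b_def by (rule positive_op_nonneg[OF P])
  show ?thesis
    unfolding a_def[symmetric] b_def[symmetric] w_def[symmetric]
  \<comment> \<open>For \<open>b = 0\<close> the quadratic is affine in \<open>s\<close>, and the
    chosen \<open>s\<close> would give it the value -1. Otherwise \<open>s = - 1 / b\<close> is its
    minimiser.\<close>
  proof (cases "b = 0")
    case True
    show "(cmod w)\<^sup>2 \<le> a * b"
    proof (rule ccontr)
      assume "\<not> ?thesis"
      then have "(cmod w)\<^sup>2 > 0" using True by simp
      then show False
        using q[of "- (a + 1) / (2 * (cmod w)\<^sup>2)"] True by (simp add: field_simps)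
    qed
  next
    case False
    then show "(cmod w)\<^sup>2 \<le> a * b"
      using \<open>0 \<le> b\<close> q[of "- 1 / b"] by (simp add: field_simps power2_eq_square)
  qed
qed

lemma positive_op_eq_0:
  assumes P: "positive_op P" and "Re (cinner (P x) x) = 0"
  shows "P x = 0"
  using positive_op_cauchy_schwarz[OF P, of x "P x"] assms(2) by (simp add: cinner_self)

section \<open>Existence and uniqueness of positive square roots\<close>

lemma blinfun_compose_assoc: "(A o\<^sub>L B) o\<^sub>L C = A o\<^sub>L (B o\<^sub>L C)"
  by (rule blinfun_eqI) simp

lemma blinfun_compose_id: "A o\<^sub>L id_blinfun = A" "id_blinfun o\<^sub>L A = A"
  by (rule blinfun_eqI, simp)+

text \<open>Fixed-point iteration for \<open>2 Y = X + Y\<^sup>2\<close>. Every iterate is a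
  polynomial in \<open>X\<close> with real coefficients, so it inherits from \<open>X\<close>
  self-adjointness and the operators that commute with it.\<close>

primrec sqrt_iter :: "('h::chilbert_space \<Rightarrow>\<^sub>L 'h) \<Rightarrow> nat \<Rightarrow> 'h \<Rightarrow>\<^sub>L 'h" where
  "sqrt_iter X 0 = 0"
| "sqrt_iter X (Suc n) = (1 / 2) *\<^sub>R (X + (sqrt_iter X n o\<^sub>L sqrt_iter X n))"

text \<open>The same iteration for the scalar 1 in place of \<open>X\<close>; it majorises the norms
  of the iterates and of their increments.\<close>

primrec sqrt_iter_bound :: "nat \<Rightarrow> real" where
  "sqrt_iter_bound 0 = 0"
| "sqrt_iter_bound (Suc n) = (1 + (sqrt_iter_bound n)\<^sup>2) / 2"

lemma sqrt_iter_bound_le_1: "0 \<le> sqrt_iter_bound n \<and> sqrt_iter_bound n \<le> 1"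
  by (induction n) (auto simp: power_le_one)

lemma sqrt_iter_commute:
  assumes "B o\<^sub>L X = X o\<^sub>L B"
  shows "B o\<^sub>L sqrt_iter X n = sqrt_iter X n o\<^sub>L B"
proof (induction n)
  case (Suc n)
  have "B o\<^sub>L (sqrt_iter X n o\<^sub>L sqrt_iter X n) = (sqrt_iter X n o\<^sub>L sqrt_iter X n) o\<^sub>L B"
    by (metis Suc blinfun_compose_assoc)
  then show ?case
    by (simp add: blinfun_compose.add_left blinfun_compose.add_right blinfun_compose.scaleR_left
        blinfun_compose.scaleR_right assms)
qed (simp add: blinfun_compose.zero_left blinfun_compose.zero_right)

lemma sqrt_iter_norm_le:
  assumes "norm X \<le> 1"
  shows "norm (sqrt_iter X n) \<le> sqrt_iter_bound n"
proof (induction n)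
  case (Suc n)
  have "norm (sqrt_iter X n o\<^sub>L sqrt_iter X n) \<le> sqrt_iter_bound n * sqrt_iter_bound n"
    using Suc sqrt_iter_bound_le_1
    by (intro order_trans[OF norm_blinfun_compose] mult_mono) auto
  then have "norm (X + (sqrt_iter X n o\<^sub>L sqrt_iter X n)) \<le> 1 + (sqrt_iter_bound n)\<^sup>2"
    using assms by (intro order_trans[OF norm_triangle_ineq] add_mono) (auto simp: power2_eq_square)
  then show ?case by simp
qed simp

text \<open>Consecutive iterates commute, so the difference of their squares factors as sum times
  difference. The scalar sequence satisfies the same identity, and the induction compares the two
  factor by factor.\<close>

lemma sqrt_iter_diff_le:
  assumes "norm X \<le> 1"
  shows "norm (sqrt_iter X (Suc n) - sqrt_iter X n) \<le> sqrt_iter_bound (Suc n) - sqrt_iter_bound n"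
proof (induction n)
  case 0
  then show ?case using assms by (simp add: blinfun_compose.zero_left)
next
  case (Suc n)
  let ?Y = "sqrt_iter X" and ?y = "sqrt_iter_bound"
  have "?Y (Suc n) o\<^sub>L ?Y n = ?Y n o\<^sub>L ?Y (Suc n)"
    by (intro sqrt_iter_commute sqrt_iter_commute[symmetric] refl)
  then have "?Y (Suc (Suc n)) - ?Y (Suc n)
      = (1 / 2) *\<^sub>R ((?Y (Suc n) + ?Y n) o\<^sub>L (?Y (Suc n) - ?Y n))"
    unfolding sqrt_iter.simps(2)[of X "Suc n"]
    by (subst (5) sqrt_iter.simps(2), simp only: blinfun_compose.add_left blinfun_compose.diff_right)
      (simp add: scaleR_diff_right[symmetric])
  moreover have "norm ((?Y (Suc n) + ?Y n) o\<^sub>L (?Y (Suc n) - ?Y n))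
      \<le> (?y (Suc n) + ?y n) * (?y (Suc n) - ?y n)"
    by (intro order_trans[OF norm_blinfun_compose] mult_mono order_trans[OF norm_triangle_ineq]
        add_mono add_nonneg_nonneg sqrt_iter_norm_le[OF assms] Suc norm_ge_zero
        conjunct1[OF sqrt_iter_bound_le_1])
  ultimately have "norm (?Y (Suc (Suc n)) - ?Y (Suc n)) \<le> (?y (Suc n) + ?y n) * (?y (Suc n) - ?y n) / 2"
    by simp
  also have "\<dots> = ?y (Suc (Suc n)) - ?y (Suc n)"
    by (subst sqrt_iter_bound.simps(2)[of "Suc n"], subst (4) sqrt_iter_bound.simps(2))
      (simp add: power2_eq_square field_simps)
  finally show ?case .
qed

lemma sqrt_iter_convergent:
  assumes "norm X \<le> 1"
  shows "convergent (sqrt_iter X)"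
proof -
  \<comment> \<open>The scalar increments dominate norms, hence are nonnegative; being also bounded
    by 1, the scalar sequence converges and its increments are summable.\<close>
  have "incseq sqrt_iter_bound"
  proof (rule incseq_SucI)
    show "sqrt_iter_bound n \<le> sqrt_iter_bound (Suc n)" for n
      using order_trans[OF norm_ge_zero sqrt_iter_diff_le[OF assms, of n]] by simp
  qed
  then obtain L where "sqrt_iter_bound \<longlonglongrightarrow> L"
    using sqrt_iter_bound_le_1 incseq_convergent by metis
  then have "summable (\<lambda>n. sqrt_iter_bound (Suc n) - sqrt_iter_bound n)"
    by (rule telescope_summable)
  then have "summable (\<lambda>n. sqrt_iter X (Suc n) - sqrt_iter X n)"
    by (rule summable_comparison_test[rotated]) (use sqrt_iter_diff_le[OF assms] in auto)
  then have "convergent (\<lambda>n. \<Sum>k<n. sqrt_iter X (Suc k) - sqrt_iter X k)"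
    by (simp add: summable_iff_convergent)
  then show ?thesis
    unfolding sum_lessThan_telescope by simp
qed

text \<open>Cauchy-Schwarz for the form of \<open>P\<close>, applied to \<open>x\<close> and
  \<open>P x\<close>, bounds the fourth power of \<open>norm (P x)\<close> by the product of the
  squares of \<open>norm x\<close> and \<open>norm (P x)\<close>.\<close>

lemma positive_op_contraction:
  assumes P: "positive_op P" and le: "\<And>x. Re (cinner (P x) x) \<le> (norm x)\<^sup>2"
  shows "norm P \<le> 1"
proof (rule norm_blinfun_bound)
  fix x
  have "(cmod (cinner (P x) (P x)))\<^sup>2 \<le> (norm x)\<^sup>2 * (norm (P x))\<^sup>2"
    using positive_op_cauchy_schwarz[OF P, of x "P x"] le positive_op_nonneg[OF P]
    by (meson mult_mono order_trans zero_le_power2)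
  then have "(norm (P x))\<^sup>2 * (norm (P x))\<^sup>2 \<le> (norm x)\<^sup>2 * (norm (P x))\<^sup>2"
    by (simp only: cinner_self norm_of_real abs_power2 abs_norm_cancel abs_mult
        power2_eq_square[of "(norm (P x))\<^sup>2"])
  then have "(norm (P x))\<^sup>2 \<le> (norm x)\<^sup>2"
    by (cases "P x = 0") (simp_all only: mult_le_cancel_right_pos zero_less_power2 norm_eq_zero
        not_False_eq_True norm_zero zero_power2 zero_le_power2 power_zero_numeral)
  then show "norm (P x) \<le> 1 * norm x"
    by (simp add: power2_le_iff_abs_le)
qed simp

lemma cinner_scaleR_left: "cinner (r *\<^sub>R x) y = of_real r * cinner x (y::'a::complex_inner)"
  by (simp add: scaleR_scaleC cinner_scaleC_left)

lemma complex_linear_scaleR: "complex_linear A \<Longrightarrow> complex_linear (r *\<^sub>R A)"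
  by (simp add: complex_linear_def blinfun.scaleR_left scaleR_scaleC scaleC_scaleC mult.commute)

text \<open>
  The limit \<open>Y\<close> of the iteration satisfies \<open>2Y = X + Y\<^sup>2\<close>, so \<open>1 - Y\<close> is a square root of \<open>1 - X\<close>.
\<close>
lemma positive_sqrt_exists_contraction:
  fixes A :: "'h::chilbert_space \<Rightarrow>\<^sub>L 'h"
  assumes A: "positive_op A" and le: "\<And>x. Re (cinner (A x) x) \<le> (norm x)\<^sup>2"
  shows "\<exists>P. positive_op P \<and> P o\<^sub>L P = A \<and> (\<forall>B. B o\<^sub>L A = A o\<^sub>L B \<longrightarrow> B o\<^sub>L P = P o\<^sub>L B)"
proof -
  define X where "X = id_blinfun - A"
  have clA: "complex_linear A"
    using A by (simp add: positive_op_def)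
  have X_apply: "X x = x - A x" for x
    by (simp add: X_def blinfun.diff_left)
  have ReX: "Re (cinner (X x) x) = (norm x)\<^sup>2 - Re (cinner (A x) x)" for x
    by (simp add: X_apply cinner_diff_left cinner_self)
  have clX: "complex_linear X"
    using clA by (simp add: complex_linear_def X_apply complex_vector.scale_right_diff_distrib)
  have X: "positive_op X"
    using A clX ReX le
    by (auto simp: positive_op_def complex_nonneg_Reals_iff X_apply cinner_diff_left cinner_self)
  have nX: "norm X \<le> 1"
    using positive_op_nonneg[OF A] by (intro positive_op_contraction X) (simp add: ReX)
  obtain Y where Y: "sqrt_iter X \<longlonglongrightarrow> Y"
    using sqrt_iter_convergent[OF nX] by (auto simp: convergent_def)
  have "(\<lambda>n. sqrt_iter X (Suc n)) \<longlonglongrightarrow> (1 / 2) *\<^sub>R (X + (Y o\<^sub>L Y))"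
    unfolding sqrt_iter.simps by (intro tendsto_intros blinfun_compose.tendsto Y)
  then have "Y = (1 / 2) *\<^sub>R (X + (Y o\<^sub>L Y))"
    using LIMSEQ_Suc[OF Y] LIMSEQ_unique by blast
  then have "2 *\<^sub>R Y = 2 *\<^sub>R ((1 / 2) *\<^sub>R (X + (Y o\<^sub>L Y)))"
    by simp
  then have YY: "Y o\<^sub>L Y = 2 *\<^sub>R Y - X"
    by simp
  have nY: "norm Y \<le> 1"
    using tendsto_norm[OF Y] sqrt_iter_norm_le[OF nX] sqrt_iter_bound_le_1
    by (intro LIMSEQ_le_const2[of "\<lambda>n. norm (sqrt_iter X n)" "norm Y" 1]) (meson order_trans)+
  have pt: "(\<lambda>n. sqrt_iter X n x) \<longlonglongrightarrow> Y x" for x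
    using Y by (intro blinfun.tendsto tendsto_const)
  have clY': "complex_linear (sqrt_iter X n)" for n
    by (induction n) (use clX in \<open>auto simp: complex_linear_def blinfun.add_left blinfun.scaleR_left
      scaleR_scaleC scaleC_scaleC scaleC_add_right mult.commute\<close>)
  have clY: "complex_linear Y"
    unfolding complex_linear_def
  proof (intro allI)
    fix c x
    have "(\<lambda>n. sqrt_iter X n (c *\<^sub>C x)) \<longlonglongrightarrow> c *\<^sub>C Y x"
      using clY' by (simp add: complex_linear_def bounded_linear.tendsto[OF bounded_linear_scaleC pt])
    then show "Y (c *\<^sub>C x) = c *\<^sub>C Y x"
      using pt LIMSEQ_unique by blast
  qed
  \<comment> \<open>Self-adjointness of the iterates makes their forms real, and reality passes to
    the limit \<open>Y\<close>. Together with \<open>norm Y \<le> 1\<close> this makes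
    \<open>id_blinfun - Y\<close> positive.\<close>
  have imY': "cinner (sqrt_iter X n x) y = cinner x (sqrt_iter X n y)" for n x y
  proof (induction n arbitrary: x y)
    case (Suc n)
    then show ?case
      using positive_op_self_adjoint[OF X, of x y]
      by (simp add: blinfun.add_left blinfun.scaleR_left scaleR_scaleC cinner_scaleC_left
          cinner_scaleC_right cinner_add_left cinner_add_right)
  qed simp
  have "Im (cinner (Y x) x) = 0" for x
  proof -
    have "Im (cinner (sqrt_iter X n x) x) = 0" for n
      using imY'[of n x x] cinner_commute[of x "sqrt_iter X n x"] by (simp add: complex_eq_iff)
    moreover have "(\<lambda>n. Im (cinner (sqrt_iter X n x) x)) \<longlonglongrightarrow> Im (cinner (Y x) x)"
      by (intro tendsto_Im bounded_linear.tendsto[OF bounded_linear_cinner_left] pt)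
    ultimately show ?thesis
      by (simp add: LIMSEQ_const_iff)
  qed
  moreover have "Re (cinner (Y x) x) \<le> (norm x)\<^sup>2" for x
  proof -
    have "Re (cinner (Y x) x) \<le> norm (Y x) * norm x"
      using complex_Re_le_cmod cmod_cinner_le order_trans by blast
    also have "norm (Y x) \<le> norm x"
      using norm_blinfun[of Y x] nY mult_right_mono[OF nY, of "norm x"] by simp
    finally show ?thesis by (simp add: power2_eq_square mult_right_mono)
  qed
  moreover have "complex_linear (id_blinfun - Y)"
    using clY by (simp add: complex_linear_def blinfun.diff_left complex_vector.scale_right_diff_distrib)
  ultimately have "positive_op (id_blinfun - Y)"
    by (simp add: positive_op_def complex_nonneg_Reals_iff blinfun.diff_left cinner_diff_left cinner_self)
  moreover have "(id_blinfun - Y) o\<^sub>L (id_blinfun - Y) = A"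
    by (simp add: blinfun_compose.diff_left blinfun_compose.diff_right YY X_def scaleR_2 blinfun_compose_id)
  \<comment> \<open>Commutation passes from \<open>A\<close> to \<open>X\<close>, to the iterates
    and to their limit. The uniqueness proof relies on this clause.\<close>
  moreover have "B o\<^sub>L (id_blinfun - Y) = (id_blinfun - Y) o\<^sub>L B" if "B o\<^sub>L A = A o\<^sub>L B" for B
  proof -
    have "B o\<^sub>L X = X o\<^sub>L B"
      using that by (simp add: X_def blinfun_compose.diff_left blinfun_compose.diff_right blinfun_compose_id)
    then have "(\<lambda>n. B o\<^sub>L sqrt_iter X n) = (\<lambda>n. sqrt_iter X n o\<^sub>L B)"
      by (simp add: sqrt_iter_commute)
    moreover have "(\<lambda>n. B o\<^sub>L sqrt_iter X n) \<longlonglongrightarrow> (B o\<^sub>L Y)"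
      "(\<lambda>n. sqrt_iter X n o\<^sub>L B) \<longlonglongrightarrow> (Y o\<^sub>L B)"
      by (intro blinfun_compose.tendsto Y tendsto_const)+
    ultimately have "B o\<^sub>L Y = Y o\<^sub>L B"
      using LIMSEQ_unique by metis
    then show ?thesis by (simp add: blinfun_compose.diff_left blinfun_compose.diff_right blinfun_compose_id)
  qed
  ultimately show ?thesis by blast
qed

lemma positive_op_scaleR:
  assumes "positive_op P" "0 \<le> r"
  shows "positive_op (r *\<^sub>R P)"
  using assms
  by (simp add: positive_op_def complex_linear_scaleR complex_nonneg_Reals_iff blinfun.scaleR_left
      cinner_scaleR_left)

lemma positive_sqrt_exists:
  fixes A :: "'h::chilbert_space \<Rightarrow>\<^sub>L 'h"
  assumes A: "positive_op A"
  shows "\<exists>P. positive_op P \<and> P o\<^sub>L P = A \<and> (\<forall>B. B o\<^sub>L A = A o\<^sub>L B \<longrightarrow> B o\<^sub>L P = P o\<^sub>L B)"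
proof -
  \<comment> \<open>Dividing by \<open>K\<close> reduces to the contractive case, and the factor
    \<open>sqrt K\<close> undoes it; the summand 1 keeps \<open>K\<close> positive when
    \<open>A\<close> is zero.\<close>
  define K where "K = norm A + 1"
  have K: "K > 0" by (simp add: K_def add_nonneg_pos)
  have "Re (cinner (((1 / K) *\<^sub>R A) x) x) \<le> (norm x)\<^sup>2" for x
  proof -
    have "Re (cinner (A x) x) \<le> norm (A x) * norm x"
      using complex_Re_le_cmod cmod_cinner_le order_trans by blast
    also have "\<dots> \<le> (norm A * norm x) * norm x"
      by (intro mult_right_mono norm_blinfun) simp
    also have "\<dots> \<le> K * (norm x)\<^sup>2"
      by (simp add: K_def power2_eq_square algebra_simps)
    finally show ?thesis
      using K by (simp add: blinfun.scaleR_left cinner_scaleR_left field_simps)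
  qed
  moreover have "positive_op ((1 / K) *\<^sub>R A)"
    using A K by (simp add: positive_op_scaleR)
  ultimately obtain P where P: "positive_op P" "P o\<^sub>L P = (1 / K) *\<^sub>R A"
    and c: "\<And>B. B o\<^sub>L ((1 / K) *\<^sub>R A) = ((1 / K) *\<^sub>R A) o\<^sub>L B \<Longrightarrow> B o\<^sub>L P = P o\<^sub>L B"
    using positive_sqrt_exists_contraction[of "(1 / K) *\<^sub>R A"] by blast
  have "positive_op (sqrt K *\<^sub>R P)"
    using P(1) K by (simp add: positive_op_scaleR)
  moreover have "(sqrt K *\<^sub>R P) o\<^sub>L (sqrt K *\<^sub>R P) = A"
    using P(2) K by (simp add: blinfun_compose.scaleR_left blinfun_compose.scaleR_right)
  moreover have "B o\<^sub>L (sqrt K *\<^sub>R P) = (sqrt K *\<^sub>R P) o\<^sub>L B" if "B o\<^sub>L A = A o\<^sub>L B" for B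
    using c[of B] that by (simp add: blinfun_compose.scaleR_left blinfun_compose.scaleR_right)
  ultimately show ?thesis by blast
qed

text \<open>Commutation gives \<open>(P + R) (P - R) = 0\<close>. For \<open>u = P x - R x\<close>
  the two nonnegative numbers \<open>cinner (P u) u\<close> and \<open>cinner (R u) u\<close> then
  add up to zero, so \<open>P u = R u = 0\<close>, and self-adjointness makes \<open>u\<close>
  orthogonal to itself.\<close>

lemma positive_sqrt_unique_aux:
  fixes P R :: "'h::chilbert_space \<Rightarrow>\<^sub>L 'h"
  assumes P: "positive_op P" and R: "positive_op R"
    and sq: "P o\<^sub>L P = R o\<^sub>L R" and comm: "P o\<^sub>L R = R o\<^sub>L P"
  shows "P = R"
proof (rule blinfun_eqI)
  fix x
  define u where "u = P x - R x"
  have sq': "P (P z) = R (R z)" and comm': "P (R z) = R (P z)" for z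
    using sq comm by (metis blinfun_apply_blinfun_compose)+
  have "P u + R u = 0"
    by (simp add: u_def blinfun.diff_right sq' comm')
  then have "Re (cinner (P u) u) + Re (cinner (R u) u) = 0"
    by (metis cinner_add_left cinner_zero_left plus_complex.sel(1) zero_complex.sel(1))
  then have "P u = 0" "R u = 0"
    using positive_op_nonneg[OF P, of u] positive_op_nonneg[OF R, of u]
    by (auto intro: positive_op_eq_0[OF P] positive_op_eq_0[OF R])
  then have "cinner u u = 0"
    using positive_op_self_adjoint[OF P, of x u] positive_op_self_adjoint[OF R, of x u]
    by (subst u_def) (simp add: cinner_diff_left)
  then show "P x = R x"
    by (simp add: cinner_self u_def)
qed

text \<open>Both roots are compared with the constructed root \<open>Q\<close>, which commutes with
  whatever commutes with the common square, in particular with \<open>P\<close> and with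
  \<open>R\<close>.\<close>

lemma positive_sqrt_unique:
  fixes P R :: "'h::chilbert_space \<Rightarrow>\<^sub>L 'h"
  assumes P: "positive_op P" and R: "positive_op R" and sq: "P o\<^sub>L P = R o\<^sub>L R"
  shows "P = R"
proof -
  have "positive_op (P o\<^sub>L P)"
    using P by (simp add: positive_op_def complex_linear_def positive_op_self_adjoint[OF P] cinner_self
        complex_nonneg_Reals_iff)
  then obtain Q where Q: "positive_op Q" "Q o\<^sub>L Q = P o\<^sub>L P"
    and c: "\<And>B. B o\<^sub>L (P o\<^sub>L P) = (P o\<^sub>L P) o\<^sub>L B \<Longrightarrow> B o\<^sub>L Q = Q o\<^sub>L B"
    using positive_sqrt_exists by metis
  have "P = Q"
    by (rule positive_sqrt_unique_aux[OF P Q(1)]) (auto simp: Q(2) blinfun_compose_assoc intro: c)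
  moreover have "R = Q"
    by (rule positive_sqrt_unique_aux[OF R Q(1)]) (auto simp: Q(2) sq blinfun_compose_assoc intro!: c)
  ultimately show ?thesis by simp
qed

section \<open>The modulus and a lower bound for the trace norm\<close>

lemma abs_op:
  fixes A :: "'h::chilbert_space \<Rightarrow>\<^sub>L 'h"
  assumes A: "complex_linear A"
  shows "positive_op (abs_op A)" and "abs_op A o\<^sub>L abs_op A = adj A o\<^sub>L A"
proof -
  have adj: "cinner x (adj A y) = cinner (A x) y" "cinner (adj A y) x = cinner y (A x)" for x y
    using cinner_adj[OF A] cinner_commute by metis+
  have "complex_linear (adj A o\<^sub>L A)"
    unfolding complex_linear_def
    by (intro allI cinner_ext) (use A in \<open>simp add: adj cinner_scaleC_right complex_linear_def\<close>)
  then have "positive_op (adj A o\<^sub>L A)"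
    by (simp add: positive_op_def adj cinner_self complex_nonneg_Reals_iff)
  then obtain P where P: "positive_op P \<and> P o\<^sub>L P = adj A o\<^sub>L A"
    using positive_sqrt_exists by blast
  then have "positive_op (abs_op A) \<and> abs_op A o\<^sub>L abs_op A = adj A o\<^sub>L A"
    unfolding abs_op_def by (rule theI) (use P positive_sqrt_unique in metis)
  then show "positive_op (abs_op A)" "abs_op A o\<^sub>L abs_op A = adj A o\<^sub>L A"
    by auto
qed

text \<open>Both sides are positive square roots of \<open>P o\<^sub>L P\<close>, as
  \<open>P\<close> is its own adjoint. This makes the trace norm of a positive operator
  computable.\<close>

lemma abs_op_positive:
  fixes P :: "'h::chilbert_space \<Rightarrow>\<^sub>L 'h"
  assumes P: "positive_op P"
  shows "abs_op P = P"
proof (rule positive_sqrt_unique)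
  have "adj P = P"
    by (rule adj_eqI) (rule positive_op_self_adjoint[OF P])
  then show "abs_op P o\<^sub>L abs_op P = P o\<^sub>L P"
    using abs_op(2)[of P] P by (simp add: positive_op_def)
qed (use P abs_op(1) in \<open>auto simp: positive_op_def\<close>)

text \<open>With \<open>P\<close> the modulus, \<open>P e\<close> and \<open>A e\<close> have equal
  norms. Cauchy-Schwarz bounds the squared coefficients of \<open>P e\<close> by products of
  diagonal entries of \<open>P\<close>, and summing them gives at most the square of the
  trace.\<close>

lemma norm_le_trace_norm:
  fixes A :: "'h::chilbert_space \<Rightarrow>\<^sub>L 'h"
  assumes A: "complex_linear A" and e: "e \<in> some_onb"
  shows "ennreal (norm (A e)) \<le> trace_norm A"
proof (cases "trace_norm A")
  case (real t)
  define P where "P = abs_op A"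
  have P: "positive_op P" "P o\<^sub>L P = adj A o\<^sub>L A"
    unfolding P_def using abs_op[OF A] by auto
  have sum_le: "(\<Sum>f\<in>F. Re (cinner (P f) f)) \<le> t" if "finite F" "F \<subseteq> some_onb" for F
  proof -
    have "(\<Sum>f\<in>F. ennreal (Re (cinner (P f) f))) \<le> trace_norm A"
      unfolding trace_norm_def P_def[symmetric]
      using that by (subst nonneg_infsum_complete) (auto intro!: SUP_upper)
    then have "ennreal (\<Sum>f\<in>F. Re (cinner (P f) f)) \<le> ennreal t"
      using real positive_op_nonneg[OF P(1)] by (simp add: sum_ennreal)
    then show ?thesis using real by simp
  qed
  have "norm (P e) \<le> t"
  proof (rule norm_le_of_coefficients[OF is_onb_some_onb])
    fix F :: "'h set" assume F: "finite F" "F \<subseteq> some_onb"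
    have "(\<Sum>f\<in>F. (cmod (cinner (P e) f))\<^sup>2)
        \<le> (\<Sum>f\<in>F. Re (cinner (P e) e) * Re (cinner (P f) f))"
      by (intro sum_mono positive_op_cauchy_schwarz P)
    also have "\<dots> = Re (cinner (P e) e) * (\<Sum>f\<in>F. Re (cinner (P f) f))"
      by (simp add: sum_distrib_left)
    also have "\<dots> \<le> t * t"
      using sum_le[of "{e}"] sum_le[OF F] e positive_op_nonneg[OF P(1)] real
      by (intro mult_mono) (auto intro: sum_nonneg)
    finally show "(\<Sum>f\<in>F. (cmod (cinner (P e) f))\<^sup>2) \<le> t\<^sup>2"
      by (simp add: power2_eq_square)
  qed (use real in simp)
  moreover have "(norm (P e))\<^sup>2 = (norm (A e))\<^sup>2"
  proof -
    have "cinner (P e) (P e) = cinner e ((P o\<^sub>L P) e)"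
      using positive_op_self_adjoint[OF P(1), of e "P e"] by simp
    also have "\<dots> = cinner (A e) (A e)"
      unfolding P(2) by (simp add: cinner_adj[OF A])
    finally show ?thesis
      by (simp only: cinner_self of_real_eq_iff)
  qed
  ultimately show ?thesis
    using real by (simp add: ennreal_leI)
qed simp

section \<open>The Hilbert space of Hilbert--Schmidt operators\<close>

lemma hilbert_schmidt_summable: "(\<lambda>e. (norm (hs_op A e))\<^sup>2) summable_on some_onb"
  and complex_linear_hs_op: "complex_linear (hs_op A)"
  using hs_op[of A] by (simp_all add: is_hilbert_schmidt_def)

lemma hilbert_schmidt_cinner_summable:
  "(\<lambda>e. cinner (hs_op A e) (hs_op B e)) summable_on some_onb"
proof (rule Infinite_Sum.abs_summable_summable, rule summable_on_comparison_test)
  show "(\<lambda>e. (norm (hs_op A e))\<^sup>2 + (norm (hs_op B e))\<^sup>2) summable_on some_onb"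
    by (intro summable_on_add hilbert_schmidt_summable)
  show "norm (cinner (hs_op A e) (hs_op B e)) \<le> (norm (hs_op A e))\<^sup>2 + (norm (hs_op B e))\<^sup>2" for e
    using cmod_cinner_le[of "hs_op A e" "hs_op B e"]
      sum_squares_bound[of "norm (hs_op A e)" "norm (hs_op B e)"]
      mult_nonneg_nonneg[OF norm_ge_zero[of "hs_op A e"] norm_ge_zero[of "hs_op B e"]]
    by linarith
qed simp

instantiation hilbert_schmidt :: (chilbert_space) complex_inner
begin

text \<open>The trace of \<open>adj (hs_op B) o\<^sub>L hs_op A\<close>, expanded in the basis that
  also defines the norm.\<close>

definition cinner_hilbert_schmidt :: "'a hilbert_schmidt \<Rightarrow> 'a hilbert_schmidt \<Rightarrow> complex"
  where "cinner_hilbert_schmidt A B = (\<Sum>\<^sub>\<infinity>e\<in>some_onb. cinner (hs_op A e) (hs_op B e))"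

instance
proof
  fix A B C :: "'a hilbert_schmidt" and a :: complex
  show "cinner A B = cnj (cinner B A)"
    by (simp add: cinner_hilbert_schmidt_def flip: infsum_cnj cinner_commute)
  show "cinner (A + B) C = cinner A C + cinner B C"
    by (simp add: cinner_hilbert_schmidt_def plus_hilbert_schmidt.rep_eq blinfun.add_left
        cinner_add_left infsum_add hilbert_schmidt_cinner_summable)
  show "cinner (a *\<^sub>C A) B = a * cinner A B"
    by (simp add: cinner_hilbert_schmidt_def scaleC_hilbert_schmidt.rep_eq cinner_scaleC_left
        infsum_cmult_right')
  have "((\<lambda>e. (norm (hs_op A e))\<^sup>2) has_sum (norm A)\<^sup>2) some_onb"
    using has_sum_infsum[OF hilbert_schmidt_summable[of A]]
    by (simp add: norm_hilbert_schmidt.rep_eq hs_norm_def infsum_nonneg)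
  then have "((\<lambda>e. cinner (hs_op A e) (hs_op A e)) has_sum of_real ((norm A)\<^sup>2)) some_onb"
    unfolding cinner_self by (rule has_sum_of_real)
  then have *: "cinner A A = of_real ((norm A)\<^sup>2)"
    unfolding cinner_hilbert_schmidt_def by (rule infsumI)
  show "cinner A A \<in> \<real>\<^sub>\<ge>\<^sub>0"
    by (simp only: * nonneg_Reals_of_real_iff zero_le_power2)
  show "norm A = sqrt (Re (cinner A A))"
    by (simp only: * Re_complex_of_real real_sqrt_abs abs_norm_cancel)
qed

end

lemma norm_hs_op_le: "e \<in> some_onb \<Longrightarrow> norm (hs_op A e) \<le> norm A"
  using L2_set_le_hs_norm[of "hs_op A" "{e}"] hs_op[of A] by (simp add: norm_hilbert_schmidt.rep_eq)

text \<open>The coefficient of \<open>adj (hs_op B) y\<close> at \<open>f\<close> is at most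
  \<open>norm (hs_op B f) * norm y\<close>, and the squares of the column norms of \<open>B\<close>
  sum to the square of its norm.\<close>

lemma norm_adj_hs_op_le:
  fixes B :: "'h::chilbert_space hilbert_schmidt"
  shows "norm (adj (hs_op B) y) \<le> norm B * norm y"
proof (rule norm_le_of_coefficients[OF is_onb_some_onb])
  fix F :: "'h set" assume F: "finite F" "F \<subseteq> some_onb"
  have "cmod (cinner (adj (hs_op B) y) f) \<le> norm (hs_op B f) * norm y" for f
  proof -
    have "cinner (adj (hs_op B) y) f = cnj (cinner (hs_op B f) y)"
      using cinner_adj[OF complex_linear_hs_op] cinner_commute by metis
    then show ?thesis using cmod_cinner_le[of "hs_op B f" y] by simp
  qed
  then have "(\<Sum>f\<in>F. (cmod (cinner (adj (hs_op B) y) f))\<^sup>2)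
      \<le> (\<Sum>f\<in>F. (norm (hs_op B f) * norm y)\<^sup>2)"
    by (intro sum_mono power_mono) auto
  also have "\<dots> = (L2_set (\<lambda>f. norm (hs_op B f)) F)\<^sup>2 * (norm y)\<^sup>2"
    by (simp add: power_mult_distrib sum_distrib_right L2_set_def sum_nonneg)
  also have "\<dots> \<le> (norm B)\<^sup>2 * (norm y)\<^sup>2"
    using L2_set_le_hs_norm[OF _ F, of "hs_op B"] hs_op[of B]
    by (intro mult_right_mono power_mono) (auto simp: norm_hilbert_schmidt.rep_eq L2_set_nonneg)
  finally show "(\<Sum>f\<in>F. (cmod (cinner (adj (hs_op B) y) f))\<^sup>2) \<le> (norm B * norm y)\<^sup>2"
    by (simp add: power_mult_distrib)
qed simp

section \<open>Enumerating the basis of a separable infinite-dimensional space\<close>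

lemma orthonormal_some_onb: "orthonormal (some_onb :: 'h::chilbert_space set)"
  using is_onb_some_onb[where 'h = 'h] by (simp add: is_onb_def)

text \<open>Distinct basis vectors lie at distance \<open>sqrt 2\<close>, so points of a countable
  dense set within 1/2 of them are distinct.\<close>

lemma countable_some_onb:
  assumes "separable_space (euclidean :: 'h::chilbert_space topology)"
  shows "countable (some_onb :: 'h set)"
proof -
  obtain C :: "'h set" where C: "countable C" "closure C = UNIV"
    using assms by (auto simp: separable_space_def)
  have ex: "\<exists>c\<in>C. dist c e < 1 / 2" for e
    using C(2) closure_approachable[of e C] by (metis UNIV_I half_gt_zero zero_less_one)
  then obtain c where c: "\<And>e. c e \<in> C" "\<And>e. dist (c e) e < 1 / 2"
    by metis
  note on = orthonormal_some_onb[where 'h = 'h]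
  have "inj_on c some_onb"
  proof (rule inj_onI, rule ccontr)
    fix e f :: 'h assume ef: "e \<in> some_onb" "f \<in> some_onb" "c e = c f" "e \<noteq> f"
    have "dist e f < 1"
      using dist_triangle_half_r[OF c(2)[of e] c(2)[of f, folded ef(3)]] by simp
    moreover have "(norm (e - f))\<^sup>2 = 2"
      using on ef by (simp add: parallelogram norm_add_square orthonormal_def)
    ultimately show False
      using power_mono[of "norm (e - f)" 1 2] by (simp add: dist_norm)
  qed
  then show ?thesis
    using C(1) c(1) by (meson countable_image_inj_on countable_subset image_subsetI)
qed

text \<open>For a finite basis the difference of \<open>x\<close> and its projection has only zero
  coefficients, so the basis would span the space.\<close>

lemma infinite_some_onb:
  assumes "\<not> finite_cdim TYPE('h::chilbert_space)"
  shows "infinite (some_onb :: 'h set)"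
proof
  assume fin: "finite (some_onb :: 'h set)"
  note on = orthonormal_some_onb[where 'h = 'h]
  have "x \<in> cspan some_onb" for x :: 'h
  proof -
    define p where "p = (\<Sum>e\<in>some_onb. cinner x e *\<^sub>C e)"
    have "cinner (x - p) f = 0" if "f \<in> some_onb" for f
      using that fin
      by (simp add: p_def cinner_diff_left cinner_sum_left cinner_scaleC_left orthonormalD[OF on]
          if_distrib cong: if_cong)
    then have "norm (x - p) \<le> 0"
      by (intro norm_le_of_coefficients[OF is_onb_some_onb]) (auto intro!: sum_nonpos)
    then have "x = p" by simp
    moreover have "p \<in> cspan some_onb"
      unfolding p_def
      by (intro complex_vector.span_sum complex_vector.span_scale complex_vector.span_base)
    ultimately show ?thesis by simp
  qed
  then show False
    using assms fin by (auto simp: finite_cdim_def)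
qed

section \<open>Hilbert-Schmidt operators as square summable sequences of columns\<close>

locale onb_sequence =
  fixes e :: "nat \<Rightarrow> 'h::chilbert_space"
  assumes bij: "bij_betw e UNIV some_onb"
begin

abbreviation col :: "'h hilbert_schmidt \<Rightarrow> nat \<Rightarrow> 'h"
  where "col A k \<equiv> hs_op A (e k)"

lemma e_mem: "e k \<in> some_onb"
  using bij by (auto simp: bij_betw_def)

lemma cinner_e: "cinner (e i) (e j) = (if i = j then 1 else 0)"
  using orthonormalD[of some_onb "e i" "e j"] is_onb_some_onb e_mem bij
  by (auto simp: is_onb_def bij_betw_def inj_eq)

lemma norm_e [simp]: "norm (e k) = 1"
  using is_onb_some_onb e_mem by (auto simp: is_onb_def orthonormal_def)

lemma norm_sums: "(\<lambda>k. (norm (col A k))\<^sup>2) sums (norm A)\<^sup>2"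
proof -
  have "((\<lambda>f. (norm (hs_op A f))\<^sup>2) has_sum (norm A)\<^sup>2) some_onb"
    using has_sum_infsum[OF hilbert_schmidt_summable[of A]]
    by (simp add: norm_hilbert_schmidt.rep_eq hs_norm_def infsum_nonneg)
  then show ?thesis
    by (intro has_sum_imp_sums has_sum_reindex_bij_betw[OF bij, THEN iffD2])
qed

lemma cinner_sums: "(\<lambda>k. cinner (col A k) (col B k)) sums cinner A B"
proof -
  have "((\<lambda>f. cinner (hs_op A f) (hs_op B f)) has_sum cinner A B) some_onb"
    unfolding cinner_hilbert_schmidt_def by (intro has_sum_infsum hilbert_schmidt_cinner_summable)
  then show ?thesis
    by (intro has_sum_imp_sums has_sum_reindex_bij_betw[OF bij, THEN iffD2])
qed

lemma cinner_single:
  assumes "\<And>k. k \<noteq> j \<Longrightarrow> cinner (col A k) (col B k) = 0"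
  shows "cinner A B = cinner (col A j) (col B j)"
  using sums_unique2[OF cinner_sums sums_finite[of "{j}"]] assms by simp

lemma col_diff: "col (A - B) k = col A k - col B k"
  by (simp add: minus_hilbert_schmidt.rep_eq blinfun.diff_left)

lemma col_ext:
  assumes "\<And>k. col A k = col B k"
  shows "A = B"
proof -
  have "(\<lambda>k. 0) sums (norm (A - B))\<^sup>2"
    using norm_sums[of "A - B"] by (simp add: col_diff assms)
  then show ?thesis
    using sums_unique2 sums_zero by fastforce
qed

text \<open>The operator is the series of the columns weighted by the coefficients of the argument.
  Cauchy-Schwarz and Bessel make it absolutely convergent and bounded by \<open>K\<close>.\<close>

lemma hilbert_schmidt_of_columns:
  assumes "summable (\<lambda>k. (norm (a k))\<^sup>2)"
  shows "\<exists>A. \<forall>k. col A k = a k"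
proof -
  define K where "K = sqrt (\<Sum>k. (norm (a k))\<^sup>2)"
  define g where "g x = (\<Sum>k. cinner x (e k) *\<^sub>C a k)" for x
  have on: "orthonormal (range e)"
    using orthonormal_some_onb bij by (simp add: bij_betw_def)
  have part: "(\<Sum>k<n. norm (cinner x (e k) *\<^sub>C a k)) \<le> norm x * K" for n x
  proof -
    have "(\<Sum>k<n. norm (cinner x (e k) *\<^sub>C a k))
        = (\<Sum>k<n. \<bar>cmod (cinner x (e k))\<bar> * \<bar>norm (a k)\<bar>)"
      by (simp add: norm_scaleC)
    also have "\<dots> \<le> L2_set (\<lambda>k. cmod (cinner x (e k))) {..<n} * L2_set (\<lambda>k. norm (a k)) {..<n}"
      by (rule L2_set_mult_ineq)
    also have "\<dots> \<le> norm x * K"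
    proof (intro mult_mono)
      have "(\<Sum>k<n. (cmod (cinner x (e k)))\<^sup>2) = (\<Sum>f\<in>e ` {..<n}. (cmod (cinner x f))\<^sup>2)"
        using bij by (subst sum.reindex) (auto simp: bij_betw_def inj_on_def)
      also have "\<dots> \<le> (norm x)\<^sup>2"
        by (rule bessel[OF on]) auto
      finally show "L2_set (\<lambda>k. cmod (cinner x (e k))) {..<n} \<le> norm x"
        unfolding L2_set_def by (simp add: real_le_lsqrt)
      show "L2_set (\<lambda>k. norm (a k)) {..<n} \<le> K"
        unfolding L2_set_def K_def using assms by (intro real_sqrt_le_mono sum_le_suminf) auto
    qed (auto simp: L2_set_nonneg)
    finally show ?thesis .
  qed
  have abs: "summable (\<lambda>k. norm (cinner x (e k) *\<^sub>C a k))" for x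
    using part[of x] by (intro summableI_nonneg_bounded[of _ "norm x * K"]) auto
  then have sm: "summable (\<lambda>k. cinner x (e k) *\<^sub>C a k)" for x
    by (rule summable_norm_cancel)
  have scale: "g (c *\<^sub>C x) = c *\<^sub>C g x" for c x
    unfolding g_def bounded_linear.suminf[OF bounded_linear_scaleC sm]
    by (simp add: cinner_scaleC_left scaleC_scaleC)
  have bl: "bounded_linear g"
  proof (rule bounded_linear_intro[where K = K])
    show "g (x + y) = g x + g y" for x y
      unfolding g_def by (simp add: suminf_add sm cinner_add_left scaleC_add_left)
    show "g (r *\<^sub>R x) = r *\<^sub>R g x" for r x
      by (simp add: scaleR_scaleC scale)
    show "norm (g x) \<le> norm x * K" for x
      unfolding g_def
      by (intro order_trans[OF summable_norm[OF abs]] suminf_le_const abs part)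
  qed
  have g_e: "g (e j) = a j" for j
    unfolding g_def
    by (subst suminf_finite[of "{j}"]) (auto simp: cinner_e scaleC_one)
  have "(\<lambda>k. (norm (g (e k)))\<^sup>2) summable_on UNIV"
    unfolding g_e using assms by (rule summable_nonneg_imp_summable_on) simp
  then have "(\<lambda>f. (norm (g f))\<^sup>2) summable_on some_onb"
    by (simp only: summable_on_reindex_bij_betw[OF bij, of "\<lambda>f. (norm (g f))\<^sup>2"])
  then have "is_hilbert_schmidt (Blinfun g)"
    by (simp add: is_hilbert_schmidt_def complex_linear_def bounded_linear_Blinfun_apply[OF bl] scale)
  then have "\<forall>k. col (Abs_hilbert_schmidt (Blinfun g)) k = a k"
    by (simp add: Abs_hilbert_schmidt_inverse bounded_linear_Blinfun_apply[OF bl] g_e)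
  then show ?thesis by blast
qed

lemma exists_unit: "\<exists>A :: 'h hilbert_schmidt. norm A = 1"
proof -
  have 1: "(\<lambda>k. (norm (if k = 0 then e 0 else 0))\<^sup>2) sums 1"
    by (rule sums_cong[THEN iffD1, OF _ sums_single[of 0 "\<lambda>_. 1 :: real"]]) simp
  obtain A where "\<forall>k. col A k = (if k = 0 then e 0 else 0)"
    using hilbert_schmidt_of_columns[OF sums_summable[OF 1]] by blast
  then have "(norm A)\<^sup>2 = 1"
    using norm_sums[of A] sums_unique2[OF _ 1] by simp
  then have "norm A = 1"
    by (simp add: power2_eq_1_iff) (metis norm_ge_zero not_one_le_zero neg_0_le_iff_le)
  then show ?thesis ..
qed

text \<open>Right multiplication by the weighted backward shift moves columns forward. The weight 4
  leaves room for two factors of 1/2 per step later: one absorbs the prescribed orbit value, the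
  other makes the inserted columns square summable.\<close>

lemma forward_shift_exists:
  "\<exists>T :: 'h hilbert_schmidt \<Rightarrow>\<^sub>L 'h hilbert_schmidt. complex_linear T \<and>
    (\<forall>A. col (T A) 0 = 0) \<and> (\<forall>A k. col (T A) (Suc k) = 4 *\<^sub>R col A k)"
proof -
  define b where "b A k = (case k of 0 \<Rightarrow> 0 | Suc j \<Rightarrow> 4 *\<^sub>R col A j)" for A k
  have b_sums: "(\<lambda>k. (norm (b A k))\<^sup>2) sums (4 * norm A)\<^sup>2" for A
  proof -
    have "(\<lambda>k. (norm (b A (Suc k)))\<^sup>2) sums (4 * norm A)\<^sup>2"
      using sums_mult[OF norm_sums[of A], of 16] by (simp add: b_def power_mult_distrib)
    from sums_Suc[OF this] show ?thesis by (simp add: b_def)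
  qed
  then have "\<exists>B. \<forall>k. col B k = b A k" for A
    using hilbert_schmidt_of_columns sums_summable by blast
  then obtain t where t: "\<And>A k. col (t A) k = b A k" by metis
  have scale: "t (c *\<^sub>C A) = c *\<^sub>C t A" for c A
    by (rule col_ext)
      (simp add: t b_def scaleC_hilbert_schmidt.rep_eq scaleR_scaleC scaleC_scaleC mult.commute
        split: nat.split)
  have bl: "bounded_linear t"
  proof (rule bounded_linear_intro[where K = 4])
    show "t (A + B) = t A + t B" for A B
      by (rule col_ext)
        (simp add: t b_def plus_hilbert_schmidt.rep_eq blinfun.add_left scaleR_add_right
          split: nat.split)
    show "t (r *\<^sub>R A) = r *\<^sub>R t A" for r A
      by (simp add: scaleR_scaleC scale)
    show "norm (t A) \<le> norm A * 4" for A
    proof -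
      have "(norm (t A))\<^sup>2 = (4 * norm A)\<^sup>2"
        using sums_unique2[OF norm_sums[of "t A"]] b_sums[of A] by (simp add: t)
      then have "norm (t A) = 4 * norm A" by (simp only: power2_eq_iff_nonneg norm_ge_zero
            mult_nonneg_nonneg zero_le_numeral)
      then show ?thesis by simp
    qed
  qed
  then show ?thesis
    by (intro exI[of _ "Blinfun t"])
      (simp add: complex_linear_def bounded_linear_Blinfun_apply scale t b_def)
qed

end

lemma exists_onb_sequence:
  assumes "separable_space (euclidean :: 'h::chilbert_space topology)"
    and "\<not> finite_cdim TYPE('h)"
  shows "\<exists>e :: nat \<Rightarrow> 'h. onb_sequence e"
  unfolding onb_sequence_def
  using bij_betw_from_nat_into[OF countable_some_onb[OF assms(1)] infinite_some_onb[OF assms(2)]]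
  by blast

section \<open>Numerical orbits and norming functionals\<close>

lemma closure_range_scaleR:
  fixes f :: "nat \<Rightarrow> 'a::real_normed_vector"
  assumes "closure (range f) = UNIV" "r \<noteq> 0"
  shows "closure (range (\<lambda>n. r *\<^sub>R f n)) = UNIV"
proof -
  have "closure (range (\<lambda>n. r *\<^sub>R f n)) = (*\<^sub>R) r ` closure (range f)"
    by (simp add: closure_scaleR image_image)
  also have "\<dots> = UNIV"
    unfolding assms(1)
  proof (rule surjI)
    show "r *\<^sub>R (inverse r *\<^sub>R x) = x" for x :: 'a using assms(2) by simp
  qed
  finally show ?thesis .
qed

definition cinner_blinfun :: "'a::complex_inner \<Rightarrow> 'a \<Rightarrow>\<^sub>L complex"
  where "cinner_blinfun a = Blinfun (\<lambda>x. cinner x a)"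

lemma cinner_blinfun_apply [simp]: "cinner_blinfun a x = cinner x a"
  by (simp add: cinner_blinfun_def bounded_linear_Blinfun_apply bounded_linear_cinner_left)

lemma norm_cinner_blinfun_le: "norm (cinner_blinfun a) \<le> norm a"
  using cmod_cinner_le[of _ a] by (intro norm_blinfun_bound) (auto simp: mult.commute)

lemma norm_cinner_blinfun_diff_le: "norm (cinner_blinfun a - cinner_blinfun b) \<le> norm (a - b)"
proof -
  have "cinner_blinfun a - cinner_blinfun b = cinner_blinfun (a - b)"
    by (rule blinfun_eqI) (simp add: blinfun.diff_left cinner_diff_right)
  then show ?thesis by (simp add: norm_cinner_blinfun_le)
qed

lemma cinner_blinfun_norming:
  assumes "norm a = 1"
  shows "(a, cinner_blinfun a) \<in> norming_pairs"
proof -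
  have "1 \<le> norm (cinner_blinfun a)"
    using norm_blinfun[of "cinner_blinfun a" a] by (simp add: cinner_self assms)
  then show ?thesis
    using norm_cinner_blinfun_le[of a] assms
    by (simp add: norming_pairs_def complex_linear_def scaleC_complex_def cinner_scaleC_left cinner_self)
qed

lemma numerically_hypercyclic_of_dense_orbit:
  fixes T :: "'a::complex_inner \<Rightarrow>\<^sub>L 'a"
  assumes "norm a = 1" "closure (range (\<lambda>n. cinner ((blinfun_apply T ^^ n) a) a)) = UNIV"
  shows "numerically_hypercyclic T"
  unfolding numerically_hypercyclic_def
  by (rule bexI[OF _ cinner_blinfun_norming[OF assms(1)]]) (simp add: assms(2))

text \<open>Every norming pair has the form \<open>(x, cinner_blinfun x)\<close>, and this pair
  depends continuously on \<open>x\<close>. Hence each nonempty open set of pairs contains one whose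
  vector has a dense orbit.\<close>

lemma topologically_numerically_transitive_of_dense_orbits:
  fixes T :: "'a::complex_inner \<Rightarrow>\<^sub>L 'a"
  assumes dense: "\<And>x \<delta>. norm x = 1 \<Longrightarrow> 0 < \<delta> \<Longrightarrow> \<exists>a. norm a = 1 \<and> norm (a - x) < \<delta> \<and>
    closure (range (\<lambda>n. cinner ((blinfun_apply T ^^ n) a) a)) = UNIV"
  shows "topologically_numerically_transitive T"
  unfolding topologically_numerically_transitive_def
proof (intro allI impI, elim conjE)
  fix U :: "('a \<times> ('a \<Rightarrow>\<^sub>L complex)) set" and V :: "complex set"
  assume U: "openin (top_of_set norming_pairs) U" "U \<noteq> {}" and V: "open V" "V \<noteq> {}"
  obtain x f where xf: "(x, f) \<in> U" using U(2) by auto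
  obtain O' where O': "open O'" "U = norming_pairs \<inter> O'"
    using U(1) by (auto simp: openin_open)
  have x: "norm x = 1" "complex_linear f" "norm f = 1" "f x = 1"
    using xf O'(2) by (auto simp: norming_pairs_def)
  have f: "f = cinner_blinfun x"
    by (rule blinfun_eqI) (simp add: norming_functional_eq_cinner[OF x(2) _ x(1) x(4)] x(3))
  obtain r where r: "r > 0" "\<And>p. dist p (x, f) < r \<Longrightarrow> p \<in> O'"
    using O' xf by (metis IntD2 open_dist)
  obtain a where a: "norm a = 1" "norm (a - x) < r / 2"
    "closure (range (\<lambda>n. cinner ((blinfun_apply T ^^ n) a) a)) = UNIV"
    using dense[OF x(1), of "r / 2"] r(1) by auto
  have "dist (a, cinner_blinfun a) (x, f) \<le> dist a x + dist (cinner_blinfun a) f"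
    unfolding dist_Pair_Pair by (rule sqrt_sum_squares_le_sum) auto
  also have "\<dots> < r"
    using a(2) norm_cinner_blinfun_diff_le[of a x] by (simp add: dist_norm f)
  finally have "(a, cinner_blinfun a) \<in> U"
    using r(2) cinner_blinfun_norming[OF a(1)] O'(2) by blast
  moreover obtain n where "cinner ((blinfun_apply T ^^ n) a) a \<in> V"
    using open_Int_closure_eq_empty[OF V(1), of "range (\<lambda>n. cinner ((blinfun_apply T ^^ n) a) a)"]
      V(2) a(3) by auto
  ultimately show "\<exists>n. \<exists>(x, f)\<in>U. blinfun_apply f ((blinfun_apply T ^^ n) x) \<in> V"
    by (intro exI[of _ n] bexI[of _ "(a, cinner_blinfun a)"]) auto
qed

section \<open>The weighted shift and the failure of C*-transitivity\<close>

locale forward_shift = onb_sequence e for e :: "nat \<Rightarrow> 'h::chilbert_space" +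
  fixes T :: "'h hilbert_schmidt \<Rightarrow>\<^sub>L 'h hilbert_schmidt"
  assumes col_0: "hs_op (T A) (e 0) = 0"
    and col_Suc: "hs_op (T A) (e (Suc k)) = 4 *\<^sub>R hs_op A (e k)"
begin

lemma col_power:
  "col ((blinfun_apply T ^^ n) A) k = (if k < n then 0 else 4 ^ n *\<^sub>R col A (k - n))"
proof (induction n arbitrary: k)
  case (Suc n)
  show ?case
    by (cases k) (simp_all add: col_0 col_Suc Suc)
qed simp

lemma not_topologically_cstar_transitive: "\<not> topologically_cstar_transitive T"
proof
  define U where "U = {C :: 'h \<Rightarrow>\<^sub>L 'h. C \<in> trace_class \<and> 1 < norm (C (e 0))}"
  have "trace_norm_open U"
    unfolding trace_norm_open_def
  proof (intro conjI ballI)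
    show "U \<subseteq> trace_class" by (auto simp: U_def)
    fix C assume C: "C \<in> U"
    have "D \<in> U" if D: "D \<in> trace_class" "trace_norm (D - C) < ennreal (norm (C (e 0)) - 1)" for D
    proof -
      have "complex_linear (D - C)"
        using C D by (simp add: U_def trace_class_def complex_linear_def blinfun.diff_left
            complex_vector.scale_right_diff_distrib)
      then have "ennreal (norm ((D - C) (e 0))) < ennreal (norm (C (e 0)) - 1)"
        using norm_le_trace_norm[OF _ e_mem] D(2) order_le_less_trans by blast
      then have "norm ((D - C) (e 0)) < norm (C (e 0)) - 1"
        by (simp add: ennreal_less_iff)
      then have "1 < norm (D (e 0))"
        using norm_triangle_ineq2[of "C (e 0)" "D (e 0)"]
        by (simp add: blinfun.diff_left norm_minus_commute)
      then show ?thesis using D(1) by (simp add: U_def)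
    qed
    then show "\<exists>\<epsilon>>0. \<forall>D\<in>trace_class. trace_norm (D - C) < ennreal \<epsilon> \<longrightarrow> D \<in> U"
      using C by (intro exI[of _ "norm (C (e 0)) - 1"]) (auto simp: U_def)
  qed
  moreover have "U \<noteq> {}"
  proof -
    \<comment> \<open>Twice the projection onto the line of \<open>e 0\<close>: a positive operator,
      hence its own modulus, with a single nonzero diagonal entry. The factor 2 pushes its value at
      \<open>e 0\<close> beyond the threshold 1.\<close>
    define R :: "'h \<Rightarrow>\<^sub>L 'h" where "R = Blinfun (\<lambda>x. (2 * cinner x (e 0)) *\<^sub>C e 0)"
    have R: "R x = (2 * cinner x (e 0)) *\<^sub>C e 0" for x
      unfolding R_def
    proof (subst bounded_linear_Blinfun_apply)
      show "bounded_linear (\<lambda>x. (2 * cinner x (e 0)) *\<^sub>C e 0)"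
        using cmod_cinner_le[of _ "e 0"]
        by (intro bounded_linear_intro[where K = 2])
          (auto simp: cinner_add_left scaleC_add_left distrib_left scaleR_scaleC cinner_scaleC_left
            scaleC_scaleC mult_ac norm_scaleC norm_mult)
    qed simp
    have inner: "cinner (R x) x = of_real (2 * (cmod (cinner x (e 0)))\<^sup>2)" for x
      using cinner_commute[of "e 0" x]
      by (simp add: R cinner_scaleC_left complex_norm_square del: of_real_power)
    have clR: "complex_linear R"
      by (simp add: complex_linear_def R cinner_scaleC_left scaleC_scaleC mult_ac)
    then have "positive_op R"
      unfolding positive_op_def inner by (auto simp del: of_real_mult of_real_power)
    then have "trace_norm R = (\<Sum>\<^sub>\<infinity>f\<in>some_onb. ennreal (2 * (cmod (cinner f (e 0)))\<^sup>2))"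
      by (simp add: trace_norm_def abs_op_positive inner del: of_real_power of_real_mult)
    also have "\<dots> = (\<Sum>\<^sub>\<infinity>f\<in>{e 0}. ennreal (2 * (cmod (cinner f (e 0)))\<^sup>2))"
      using e_mem orthonormal_some_onb by (intro infsum_cong_neutral) (auto simp: orthonormal_def)
    also have "\<dots> < \<infinity>" by simp
    finally have "R \<in> trace_class"
      using clR by (simp add: trace_class_def)
    moreover have "norm (R (e 0)) = 2"
      by (simp add: R cinner_e norm_scaleC)
    ultimately show ?thesis by (auto simp: U_def)
  qed
  moreover obtain A :: "'h hilbert_schmidt" where "norm A = 1"
    using exists_unit by blast
  then have "sphere (0 :: 'h hilbert_schmidt) 1 \<times> sphere (0 :: 'h hilbert_schmidt) 1 \<noteq> {}"
    by auto
  moreover assume "topologically_cstar_transitive T"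
  ultimately obtain n A B where AB: "norm A = 1" "norm B = 1"
    "adj (hs_op B) o\<^sub>L hs_op ((blinfun_apply T ^^ n) A) \<in> U"
    unfolding topologically_cstar_transitive_def
    by (force dest!: spec[of _ "sphere 0 1 \<times> sphere 0 1"] spec[of _ U])
  \<comment> \<open>Column 0 is that of \<open>A\<close> for \<open>n = 0\<close> and vanishes for
    all later \<open>n\<close>.\<close>
  have "norm (col ((blinfun_apply T ^^ n) A) 0) \<le> 1"
    using norm_hs_op_le[OF e_mem, of A 0] AB(1) by (simp add: col_power)
  then have "norm (adj (hs_op B) (col ((blinfun_apply T ^^ n) A) 0)) \<le> 1"
    using norm_adj_hs_op_le[of B] AB(2) by (metis mult_1 order_trans)
  then show False
    using AB(3) by (simp add: U_def)
qed

end

section \<open>Dense numerical orbits near every unit vector\<close>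

lemma exists_dense_sequence: "\<exists>c :: nat \<Rightarrow> 'a::second_countable_topology. closure (range c) = UNIV"
proof -
  obtain D :: "'a set" where D: "countable D" "\<And>X. open X \<Longrightarrow> X \<noteq> {} \<Longrightarrow> \<exists>d\<in>D. d \<in> X"
    using countable_dense_exists by blast
  have "D \<noteq> {}" using D(2)[of UNIV] by auto
  moreover have "closure D = UNIV"
    using D(2)[of "- closure D"] closure_subset[of D] by (auto simp: open_Compl)
  ultimately show ?thesis
    using D(1) by (intro exI[of _ "from_nat_into D"]) (simp add: range_from_nat_into)
qed

lemma exists_large_power_small:
  assumes "0 < (t::real)"
  shows "\<exists>m\<ge>M. s * (1 / 2) ^ m \<le> t"
proof -
  have "(\<lambda>m. s * (1 / 2) ^ m) \<longlonglongrightarrow> s * 0"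
    by (intro tendsto_mult tendsto_const LIMSEQ_realpow_zero) auto
  then have "\<forall>\<^sub>F m in sequentially. s * (1 / 2) ^ m < t"
    using assms by (auto dest: order_tendstoD(2))
  then obtain K where "\<And>m. m \<ge> K \<Longrightarrow> s * (1 / 2) ^ m < t"
    by (auto simp: eventually_sequentially)
  then show ?thesis
    by (intro exI[of _ "max M K"]) (simp add: less_imp_le)
qed

context forward_shift
begin

text \<open>
  The columns of \<open>x\<close> are cut off at \<open>N\<close>, and multiples of a fixed nonzero column \<open>u\<close>, at position
  \<open>k0\<close>, are inserted at sparse positions \<open>n j + k0\<close>. As the positions at least double at each
  step, the only nonzero column of \<open>A\<close> that \<open>T\<close> to the power \<open>n j\<close> moves to the position of a
  nonzero column of \<open>A\<close> is the one at \<open>k0\<close>.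
\<close>
lemma dense_orbit_near:
  fixes x :: "'h hilbert_schmidt"
  assumes x: "x \<noteq> 0" and \<delta>: "0 < \<delta>"
  shows "\<exists>A. norm (A - x) < \<delta> \<and>
    closure (range (\<lambda>n. cinner ((blinfun_apply T ^^ n) A) A)) = UNIV"
proof -
  obtain k0 where k0: "col x k0 \<noteq> 0"
    using x col_ext[of x 0] by (auto simp: zero_hilbert_schmidt.rep_eq)
  \<comment> \<open>The cut comes after \<open>k0\<close>, so column \<open>k0\<close> of
    \<open>x\<close> survives it.\<close>
  obtain N where N: "k0 < N" "(norm x)\<^sup>2 - (\<Sum>k<N. (norm (col x k))\<^sup>2) < \<delta>\<^sup>2 / 8"
  proof -
    have "(\<lambda>N. \<Sum>k<N. (norm (col x k))\<^sup>2) \<longlonglongrightarrow> (norm x)\<^sup>2"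
      using norm_sums by (simp add: sums_def)
    moreover have "(norm x)\<^sup>2 - \<delta>\<^sup>2 / 8 < (norm x)\<^sup>2" using \<delta> by simp
    ultimately have "\<forall>\<^sub>F N in sequentially. (norm x)\<^sup>2 - \<delta>\<^sup>2 / 8 < (\<Sum>k<N. (norm (col x k))\<^sup>2)"
      by (rule order_tendstoD(1))
    then obtain M where "\<And>N. N \<ge> M \<Longrightarrow> (norm x)\<^sup>2 - \<delta>\<^sup>2 / 8 < (\<Sum>k<N. (norm (col x k))\<^sup>2)"
      by (auto simp: eventually_sequentially)
    from this[of "max M (Suc k0)"] show ?thesis
      by (intro that[of "max M (Suc k0)"]) auto
  qed
  define u where "u = col x k0"
  have u: "norm u > 0" using k0 by (simp add: u_def)
  obtain c :: "nat \<Rightarrow> complex" where c: "closure (range c) = UNIV"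
    using exists_dense_sequence by blast
  define \<eta> where "\<eta> = \<delta> / 4"
  have \<eta>: "\<eta> > 0" using \<delta> by (simp add: \<eta>_def)
  \<comment> \<open>Chosen so that \<open>norm (z j)\<close> below equals
    \<open>s j * (1 / 2) ^ n j * (1 / 2) ^ m j\<close>; the power of 2 compensates for the offset
    \<open>k0\<close> in \<open>m j\<close>.\<close>
  define s where "s j = cmod (c j) / norm u * 2 ^ k0" for j
  have "\<exists>n. \<forall>j. (N \<le> n j \<and> s j * (1 / 2) ^ n j \<le> \<eta>) \<and> 2 * n j + N \<le> n (Suc j)"
  proof (rule dependent_nat_choice)
    show "\<exists>m. N \<le> m \<and> s 0 * (1 / 2) ^ m \<le> \<eta>"
      using exists_large_power_small[OF \<eta>] by blast
    show "\<exists>m'. (N \<le> m' \<and> s (Suc j) * (1 / 2) ^ m' \<le> \<eta>) \<and> 2 * m + N \<le> m'" for m j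
      using exists_large_power_small[OF \<eta>, of "2 * m + N" "s (Suc j)"] by (metis add_leD2)
  qed
  then obtain n where n: "\<And>j. N \<le> n j" "\<And>j. s j * (1 / 2) ^ n j \<le> \<eta>"
    "\<And>j. 2 * n j + N \<le> n (Suc j)"
    by blast
  have gap: "2 * n i + N \<le> n l" if "i < l" for i l
    using that
  proof (induction l)
    case (Suc l)
    then show ?case using n(3)[of l] by (cases "i = l") auto
  qed simp
  define m where "m j = n j + k0" for j
  have "inj m"
  proof (rule linorder_injI)
    show "m i \<noteq> m l" if "i < l" for i l
      using gap[OF that] N(1) by (simp add: m_def)
  qed
  \<comment> \<open>The coefficient solves \<open>cinner (4 ^ n j *\<^sub>R u) (z j) = c j\<close>;
    the conjugate appears because the second argument of \<open>cinner\<close> is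
    conjugate-linear.\<close>
  define z where "z j = (cnj (c j) / of_real (4 ^ n j * (norm u)\<^sup>2)) *\<^sub>C u" for j
  define b where "b k = (if k \<in> range m then z (inv m k) else 0)" for k
  have b_m: "b (m j) = z j" for j
    using \<open>inj m\<close> by (simp add: b_def)
  have norm_z: "norm (z j) \<le> \<eta> * (1 / 2) ^ m j" for j
  proof -
    have "norm (z j) = s j * (1 / 2) ^ n j * (1 / 2) ^ m j"
    proof -
      have "(4::real) ^ n j = 2 ^ n j * 2 ^ n j"
        by (simp flip: power_mult_distrib)
      then show ?thesis
        using u by (simp add: z_def s_def m_def norm_scaleC norm_divide norm_mult norm_power power_add
            power_one_over field_simps power2_eq_square)
    qed
    then show ?thesis using n(2)[of j] by (simp add: mult_right_mono)
  qed
  then have norm_b: "norm (b k) \<le> \<eta> * (1 / 2) ^ k" for k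
    using \<eta> b_m by (cases "k \<in> range m") (auto simp: b_def)
  define d where "d k = (if k < N then 0 else b k - col x k)" for k
  \<comment> \<open>The tail of \<open>x\<close> from \<open>N\<close> on, written as the full
    series minus a finite part so that its sum is explicit.\<close>
  define t where "t k = (norm (col x k))\<^sup>2 - (if k \<in> {..<N} then (norm (col x k))\<^sup>2 else 0)" for k
  define g where "g k = 2 * (\<eta>\<^sup>2 * (1 / 4) ^ k) + 2 * t k" for k
  have d_le: "(norm (d k))\<^sup>2 \<le> g k" for k
  proof (cases "k < N")
    case False
    have "(norm (d k))\<^sup>2 \<le> 2 * (norm (b k))\<^sup>2 + 2 * (norm (col x k))\<^sup>2"
      using parallelogram[of "b k" "col x k"] False by (simp add: d_def)
    moreover have "(norm (b k))\<^sup>2 \<le> (\<eta> * (1 / 2) ^ k)\<^sup>2"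
      by (intro power_mono norm_b) simp
    moreover have "(\<eta> * (1 / 2) ^ k)\<^sup>2 = \<eta>\<^sup>2 * (1 / 4) ^ k"
      by (simp add: power_mult_distrib power2_eq_square flip: power_mult_distrib)
    ultimately show ?thesis using False by (simp add: g_def t_def)
  qed (simp add: d_def g_def t_def)
  have "(\<lambda>k. (1 / 4 :: real) ^ k) sums (4 / 3)"
    using geometric_sums[of "1 / 4 :: real"] by simp
  then have g_sums: "g sums (2 * (\<eta>\<^sup>2 * (4 / 3)) + 2 * ((norm x)\<^sup>2 - (\<Sum>k<N. (norm (col x k))\<^sup>2)))"
    unfolding g_def t_def
    by (intro sums_add sums_mult sums_diff norm_sums sums_If_finite_set) auto
  have "summable (\<lambda>k. (norm (d k))\<^sup>2)"
    using sums_summable[OF g_sums] by (rule summable_comparison_test') (simp add: d_le)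
  then obtain D where D: "\<And>k. col D k = d k"
    using hilbert_schmidt_of_columns by blast
  have "(norm D)\<^sup>2 \<le> 2 * (\<eta>\<^sup>2 * (4 / 3)) + 2 * ((norm x)\<^sup>2 - (\<Sum>k<N. (norm (col x k))\<^sup>2))"
    by (rule sums_le[OF _ norm_sums g_sums]) (simp add: D d_le)
  also have "\<dots> < 2 * (\<eta>\<^sup>2 * (4 / 3)) + 2 * (\<delta>\<^sup>2 / 8)"
    using N(2) by simp
  also have "\<dots> \<le> \<delta>\<^sup>2"
    by (simp add: \<eta>_def power_divide)
  finally have norm_D: "norm D < \<delta>"
    using \<delta> by (meson less_imp_le power_less_imp_less_base)
  define A where "A = x + D"
  have col_A: "col A k = (if k < N then col x k else b k)" for k
    by (simp add: A_def plus_hilbert_schmidt.rep_eq blinfun.add_left D d_def)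
  have "cinner ((blinfun_apply T ^^ n j) A) A = c j" for j
  proof -
    have "cinner ((blinfun_apply T ^^ n j) A) A
        = cinner (col ((blinfun_apply T ^^ n j) A) (m j)) (col A (m j))"
    proof (rule cinner_single)
      fix k assume k: "k \<noteq> m j"
      show "cinner (col ((blinfun_apply T ^^ n j) A) k) (col A k) = 0"
      proof (cases "n j \<le> k \<and> k \<in> range m")
        case True
        then obtain l where l: "k = n l + k0" by (auto simp: m_def)
        have "j < l"
        proof (rule ccontr)
          assume "\<not> j < l"
          then have "l < j" using k l by (cases "l = j") (auto simp: m_def)
          then show False using gap[of l j] True l N(1) by simp
        qed
        then have ge: "N \<le> k - n j" using gap[of j l] l by simp
        \<comment> \<open>Otherwise \<open>n l = n i + n j\<close> with both \<open>i\<close> and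
          \<open>j\<close> below \<open>l\<close>. But the gaps make \<open>n l\<close> exceed twice
          each summand, hence exceed their sum.\<close>
        have "k - n j \<notin> range m"
        proof
          assume "k - n j \<in> range m"
          then obtain i where "k - n j = n i + k0" by (auto simp: m_def)
          then have i: "n l = n i + n j" using l True by linarith
          have "n j > 0" using n(1)[of j] N(1) by simp
          then have "\<not> l \<le> i" using i gap[of l i] by (cases "l = i") auto
          then show False
            using i gap[of i l] gap[OF \<open>j < l\<close>] N(1) by simp
        qed
        then show ?thesis using ge by (simp add: col_power col_A b_def)
      next
        case False
        moreover have "col A k = 0" if "n j \<le> k" "k \<notin> range m"
          using that n(1)[of j] by (simp add: col_A b_def)
        ultimately show ?thesis by (auto simp: col_power)
      qed
    qed
    also have "\<dots> = cinner (4 ^ n j *\<^sub>R u) (z j)"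
      using N(1) n(1)[of j] by (simp add: col_power col_A m_def u_def flip: b_m)
    also have "\<dots> = c j"
      using u by (simp add: z_def cinner_scaleR_left cinner_scaleC_right cinner_self)
    finally show ?thesis .
  qed
  then have "range c \<subseteq> range (\<lambda>k. cinner ((blinfun_apply T ^^ k) A) A)"
    by (metis image_subsetI rangeI)
  then have "closure (range (\<lambda>k. cinner ((blinfun_apply T ^^ k) A) A)) = UNIV"
    using c closure_mono by (metis top.extremum_uniqueI)
  then show ?thesis
    using norm_D by (intro exI[of _ A]) (simp add: A_def)
qed

text \<open>Normalising a nearby vector with dense orbit multiplies all orbit values by the same
  positive number, which preserves density.\<close>

lemma unit_dense_orbit_near:
  fixes x :: "'h hilbert_schmidt"
  assumes x: "norm x = 1" and \<delta>: "0 < \<delta>"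
  shows "\<exists>A. norm A = 1 \<and> norm (A - x) < \<delta> \<and>
    closure (range (\<lambda>n. cinner ((blinfun_apply T ^^ n) A) A)) = UNIV"
proof -
  \<comment> \<open>The bound 1 keeps \<open>A\<close> nonzero. The half is for the normalisation,
    which moves \<open>A\<close> by at most \<open>norm (A - x)\<close> again.\<close>
  have "0 < min (\<delta> / 2) 1" "x \<noteq> 0" using \<delta> x by auto
  then obtain A where A: "norm (A - x) < min (\<delta> / 2) 1"
    "closure (range (\<lambda>n. cinner ((blinfun_apply T ^^ n) A) A)) = UNIV"
    using dense_orbit_near by blast
  have A0: "norm A > 0" using A(1) x by auto
  define r where "r = 1 / norm A"
  have pow: "(blinfun_apply T ^^ n) (r *\<^sub>R A) = r *\<^sub>R (blinfun_apply T ^^ n) A" for n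
    by (induction n) (simp_all add: blinfun.scaleR_right)
  have "cinner ((blinfun_apply T ^^ n) (r *\<^sub>R A)) (r *\<^sub>R A)
      = r\<^sup>2 *\<^sub>R cinner ((blinfun_apply T ^^ n) A) A" for n
    unfolding pow
    by (simp add: scaleR_scaleC[of r] cinner_scaleC_left cinner_scaleC_right scaleR_conv_of_real
        power2_eq_square)
  moreover have "closure (range (\<lambda>n. r\<^sup>2 *\<^sub>R cinner ((blinfun_apply T ^^ n) A) A)) = UNIV"
    using A0 by (intro closure_range_scaleR A(2)) (simp add: r_def)
  ultimately have "closure (range (\<lambda>n. cinner ((blinfun_apply T ^^ n) (r *\<^sub>R A)) (r *\<^sub>R A))) = UNIV"
    by simp
  moreover have "norm (r *\<^sub>R A) = 1"
    using A0 by (simp add: r_def)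
  moreover have "norm (r *\<^sub>R A - x) < \<delta>"
  proof -
    have "r *\<^sub>R A - A = (r - 1) *\<^sub>R A" by (simp add: scaleR_left_diff_distrib)
    then have "norm (r *\<^sub>R A - A) = \<bar>r - 1\<bar> * norm A" by simp
    also have "\<dots> = \<bar>1 - norm A\<bar>"
      using A0 by (simp add: r_def abs_mult_pos[symmetric] field_simps flip: abs_mult)
    also have "\<dots> \<le> norm (A - x)"
      using norm_triangle_ineq3[of A x] x by (simp add: abs_minus_commute)
    finally have "norm (r *\<^sub>R A - A) < \<delta> / 2" using A(1) by simp
    then show ?thesis
      using norm_triangle_ineq[of "r *\<^sub>R A - A" "A - x"] A(1) by simp
  qed
  ultimately show ?thesis by blast
qed

lemma numerically_transitive: "topologically_numerically_transitive T"
  by (rule topologically_numerically_transitive_of_dense_orbits) (rule unit_dense_orbit_near)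

lemma hypercyclic: "numerically_hypercyclic T"
proof -
  obtain x :: "'h hilbert_schmidt" where "norm x = 1" using exists_unit by blast
  then show ?thesis
    using unit_dense_orbit_near[of x 1] numerically_hypercyclic_of_dense_orbit by auto
qed

end

theorem proposition4p10:
  assumes "separable_space (euclidean :: 'h::chilbert_space topology)"
    and "\<not> finite_cdim TYPE('h)"
  shows "(\<exists>T :: 'h hilbert_schmidt \<Rightarrow>\<^sub>L 'h hilbert_schmidt. complex_linear T \<and>
            topologically_numerically_transitive T \<and> \<not> topologically_cstar_transitive T) \<and>
         (\<exists>T :: 'h hilbert_schmidt \<Rightarrow>\<^sub>L 'h hilbert_schmidt. complex_linear T \<and>
            numerically_hypercyclic T \<and> \<not> topologically_cstar_transitive T)"
proof -
  obtain e :: "nat \<Rightarrow> 'h" where e: "onb_sequence e"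
    using exists_onb_sequence[OF assms] by blast
  then obtain T :: "'h hilbert_schmidt \<Rightarrow>\<^sub>L 'h hilbert_schmidt" where T: "complex_linear T"
    and col: "\<And>A. hs_op (T A) (e 0) = 0" "\<And>A k. hs_op (T A) (e (Suc k)) = 4 *\<^sub>R hs_op A (e k)"
    using onb_sequence.forward_shift_exists by blast
  interpret forward_shift e T
    using e col by (simp add: forward_shift_def forward_shift_axioms_def)
  show ?thesis
    using T numerically_transitive hypercyclic
      not_topologically_cstar_transitive by blast
qed

end
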